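(* Let $f:\mathbb{R}^d\to\mathbb{R}\cup\{\infty\}$ be convex and $\ell$-smooth, attaining its minimum at $x^*\in\mathbb{R}^d$, let $x^0\in\mathcal{X}$, $\Delta:=f(x^0)-f(x^* )$, and let $\bar R>0$ satisfy $\bar R\ge\|x^0-x^*\|$. Let $\psi:\mathbb{R}_+\to\mathbb{R}_+$, $\psi(x)=\frac{x^2}{2\ell(4x)}$ (not necessarily strictly increasing), and let $\Delta_{\max}\in(0,\infty]$ be the largest value such that $\psi$ is strictly increasing on $[0,\Delta_{\max})$. For $\delta\in[0,\psi(\Delta_{\max}))$ let $\Delta_{\mathrm{left}}(\delta)\in[0,\Delta_{\max})$ be the unique point and $\Delta_{\mathrm{right}}(\delta)\in[\Delta_{\max},\infty]$ the smallest point such that $\psi(\Delta_{\mathrm{left}}(\delta))=\delta$ and $\psi(\Delta_{\mathrm{right}}(\delta))=\delta$ (with $\Delta_{\mathrm{right}}(\delta)=\infty$ if $\{x\in[\Delta_{\max},\infty):\psi(x)=\delta\}$ is empty). Let $$M_{\bar R}:=\max_{f(x)-f(x^* )\le\Delta,\ \|x-x^*\|\le 2\bar R}\|\nabla f(x)\|$$ (or let $M_{\bar R}$ be any upper bound on this maximum), and $$Q:=\left\{\delta\in\left[0,\tfrac12\psi(\Delta_{\max})\right]:\ \ell(4\Delta_{\mathrm{left}}(\delta))\le 2\ell(0),\ \Delta_{\mathrm{right}}(\delta)\ge 2M_{\bar R},\ \delta\le\Delta\right\}.$$ Let $\varepsilon>0$. Then for every $\delta\in Q$, the oracle complexity (number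 of gradient calls) required by Algorithm 1 with parameters $\delta,\bar R$ to find an $\varepsilon$-solution is at most (rounded up to an integer) $$\frac{5\sqrt{\ell(0)}\,\bar R}{\sqrt{\varepsilon}}+k(\delta),\qquad k(\delta):=\max\left\{1+\frac12\log_{3/2}\left(\frac{\delta}{8\ell(0)\bar R^2}\right),0\right\}+k_{\mathrm{GD}}(\delta),$$ where $k_{\mathrm{GD}}(\delta)$ is the oracle complexity of GD (Phase 1 of Algorithm 1, started at $x^0$) for finding a point $\bar x$ such that $f(\bar x)-f(x^* )\le\delta/2$.
   Context: $\|\cdot\|$ is the Euclidean norm for vectors and the spectral norm for matrices; $\mathbb{R}_+=[0,\infty)$. An $\varepsilon$-solution is a point $\bar x\in\mathbb{R}^d$ with $f(\bar x)-\inf_{x} f(x)\le\varepsilon$. If $\Delta_{\max}=\infty$, then $\psi(\Delta_{\max})$ means $\lim_{x\to\infty}\psi(x)\in(0,\infty]$, $\Delta_{\mathrm{right}}(\delta)=\infty$, and $\delta$ is always finite. Setting: $f:\mathbb{R}^d\to\mathbb{R}\cup\{\infty\}$, $\mathcal{X}:=\{x\in\mathbb{R}^d: f(x)<\infty\}$ is assumed to be an open, $d$-dimensional (nonempty) convex set, and $\bar{\mathcal{X}}$ denotes its closure; $\mathrm{Proj}_{\bar{\mathcal{X}}}$ is the Euclidean projection onto $\bar{\mathcal{X}}$. $f$ is $\ell$-smooth if $f$ is twice differentiable on $\mathcal{X}$, continuous on $\bar{\mathcal{X}}$, and $\ell:[0,\infty)\to(0,\infty)$ is a non-decreasing, positive,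 locally Lipschitz function with $\|\nabla^2 f(x)\|\le \ell(\|\nabla f(x)\|)$ for all $x\in\mathcal{X}$. Algorithm 1 (input: $x^0\in\mathcal{X}$, $\ell$, $\delta$, $\bar R$). Phase 1: starting from $x^0$, run gradient descent (GD) $x^{j+1}=x^j-\eta_j\nabla f(x^j)$ with $\eta_j=\int_0^1\frac{dv}{\ell(\|\nabla f(x^j)\|+\|\nabla f(x^j)\|v)}$ until a point $\bar x$ with $f(\bar x)-f(x^* )\le\delta/2$ is reached. Phase 2: set $y^0=u^0=\bar x$, $\Gamma_0=\delta/\bar R^2$, $\gamma=1/(2\ell(0))$, and for $k=0,1,2,\dots$: $\alpha_k=\sqrt{\gamma\Gamma_k}$; $y^{k+1}=\frac{1}{1+\alpha_k}y^k+\frac{\alpha_k}{1+\alpha_k}u^k-\frac{\gamma}{1+\alpha_k}\nabla f(y^k)$; $u^{k+1}=\mathrm{Proj}_{\bar{\mathcal{X}}}\left(u^k-\frac{\alpha_k}{\Gamma_k}\nabla f(y^{k+1})\right)$; $\Gamma_{k+1}=\Gamma_k/(1+\alpha_k)$. One new gradient is computed per iteration. Conventions for the degenerate value $\delta=0$: $\log 0=-\infty$, $k_{\mathrm{GD}}(0)=\infty$ if GD does not reach a minimizer in finitely many steps (the bound is then vacuous), and if it does, the point $\bar x$ is already an $\varepsilon$-solution. *)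

theory Defs
  imports "HOL-Analysis.Analysis"
begin

section \<open>Extended-real-valued functions and \<open>ell\<close>-smoothness\<close>

definition edom :: "('a \<Rightarrow> ereal) \<Rightarrow> 'a set" where
  "edom f = {x. f x < \<infinity>}"

text \<open>The gradient is meaningful only at points of the (open) set \<open>edom f\<close>; elsewhere its
  value is junk.\<close>

definition grad :: "(real ^ 'n \<Rightarrow> ereal) \<Rightarrow> real ^ 'n \<Rightarrow> real ^ 'n" where
  "grad f x = (THE g. GDERIV (\<lambda>z. real_of_ereal (f z)) x :> g)"

definition hessian :: "(real ^ 'n \<Rightarrow> ereal) \<Rightarrow> real ^ 'n \<Rightarrow> real ^ 'n ^ 'n" where
  "hessian f x = jacobian (grad f) (at x)"

definition spectral_norm :: "real ^ 'n ^ 'n \<Rightarrow> real" where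
  "spectral_norm A = onorm ((*v) A)"

definition twice_differentiable_on_edom :: "(real ^ 'n \<Rightarrow> ereal) \<Rightarrow> bool" where
  "twice_differentiable_on_edom f \<longleftrightarrow>
     (\<forall>x\<in>edom f. (\<lambda>z. real_of_ereal (f z)) differentiable (at x) \<and> grad f differentiable (at x))"

definition locally_lipschitz_on :: "real set \<Rightarrow> (real \<Rightarrow> real) \<Rightarrow> bool" where
  "locally_lipschitz_on S g \<longleftrightarrow> (\<forall>s\<in>S. \<exists>u>0. \<exists>L. L-lipschitz_on (cball s u \<inter> S) g)"

text \<open>Continuity on the closure is with respect to the topology of the extended reals; since
  \<open>edom f\<close> is open, it forces \<open>f\<close> to tend to \<open>\<infinity>\<close> at the boundary.\<close>

definition ell_smooth :: "(real \<Rightarrow> real) \<Rightarrow> (real ^ 'n \<Rightarrow> ereal) \<Rightarrow> bool" where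
  "ell_smooth ell f \<longleftrightarrow>
     twice_differentiable_on_edom f \<and>
     continuous_on (closure (edom f)) f \<and>
     mono_on {0..} ell \<and> (\<forall>s\<ge>0. ell s > 0) \<and> locally_lipschitz_on {0..} ell \<and>
     (\<forall>x\<in>edom f. spectral_norm (hessian f x) \<le> ell (norm (grad f x)))"

definition eps_solution :: "(real ^ 'n \<Rightarrow> ereal) \<Rightarrow> real \<Rightarrow> real ^ 'n \<Rightarrow> bool" where
  "eps_solution f \<epsilon> x \<longleftrightarrow> f x - (INF y. f y) \<le> ereal \<epsilon>"


section \<open>The algorithm and its oracle complexity\<close>

text \<open>For a sequence \<open>z\<close> in which the computation of \<open>z n\<close> from \<open>z 0\<close> calls the gradient oracle
  exactly at \<open>z 0, \<dots>, z (n - 1)\<close>: the number of calls made until the first \<open>z n\<close> with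
  property \<open>P\<close> is available. The oracle answers only on \<open>edom f\<close>, so all queried points
  are required to lie there. The value is \<open>\<infinity>\<close> if there is no such \<open>n\<close>.\<close>

definition oracle_complexity ::
    "(real ^ 'n \<Rightarrow> ereal) \<Rightarrow> (nat \<Rightarrow> real ^ 'n) \<Rightarrow> (real ^ 'n \<Rightarrow> bool) \<Rightarrow> enat" where
  "oracle_complexity f z P = Inf {enat n |n. P (z n) \<and> (\<forall>m<n. z m \<in> edom f)}"

definition gd_stepsize :: "(real ^ 'n \<Rightarrow> ereal) \<Rightarrow> (real \<Rightarrow> real) \<Rightarrow> real ^ 'n \<Rightarrow> real" where
  "gd_stepsize f ell x = integral {0..1} (\<lambda>v. 1 / ell (norm (grad f x) + norm (grad f x) * v))"

primrec gd :: "(real ^ 'n \<Rightarrow> ereal) \<Rightarrow> (real \<Rightarrow> real) \<Rightarrow> real ^ 'n \<Rightarrow> nat \<Rightarrow> real ^ 'n" where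
  "gd f ell x0 0 = x0"
| "gd f ell x0 (Suc j) = gd f ell x0 j - gd_stepsize f ell (gd f ell x0 j) *\<^sub>R grad f (gd f ell x0 j)"

definition k_GD ::
    "(real ^ 'n \<Rightarrow> ereal) \<Rightarrow> (real \<Rightarrow> real) \<Rightarrow> real ^ 'n \<Rightarrow> real ^ 'n \<Rightarrow> real \<Rightarrow> enat" where
  "k_GD f ell xs x0 \<delta> =
     oracle_complexity f (gd f ell x0) (\<lambda>x. f x - f xs \<le> ereal (\<delta> / 2))"

text \<open>The state of Phase 2 is the triple \<open>(y, u, \<Gamma>)\<close>.\<close>

definition phase2_step ::
    "(real ^ 'n \<Rightarrow> ereal) \<Rightarrow> (real \<Rightarrow> real) \<Rightarrow>
     (real ^ 'n) \<times> (real ^ 'n) \<times> real \<Rightarrow> (real ^ 'n) \<times> (real ^ 'n) \<times> real" where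
  "phase2_step f ell = (\<lambda>(y, u, \<Gamma>).
     let \<gamma> = 1 / (2 * ell 0);
         \<alpha> = sqrt (\<gamma> * \<Gamma>);
         y' = (1 / (1 + \<alpha>)) *\<^sub>R y + (\<alpha> / (1 + \<alpha>)) *\<^sub>R u - (\<gamma> / (1 + \<alpha>)) *\<^sub>R grad f y;
         u' = closest_point (closure (edom f)) (u - (\<alpha> / \<Gamma>) *\<^sub>R grad f y')
     in (y', u', \<Gamma> / (1 + \<alpha>)))"

primrec phase2 ::
    "(real ^ 'n \<Rightarrow> ereal) \<Rightarrow> (real \<Rightarrow> real) \<Rightarrow> real \<Rightarrow> real \<Rightarrow> real ^ 'n \<Rightarrow> nat \<Rightarrow>
     (real ^ 'n) \<times> (real ^ 'n) \<times> real" where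
  "phase2 f ell \<delta> R xbar 0 = (xbar, xbar, \<delta> / R\<^sup>2)"
| "phase2 f ell \<delta> R xbar (Suc k) = phase2_step f ell (phase2 f ell \<delta> R xbar k)"

definition phase2_y ::
    "(real ^ 'n \<Rightarrow> ereal) \<Rightarrow> (real \<Rightarrow> real) \<Rightarrow> real \<Rightarrow> real \<Rightarrow> real ^ 'n \<Rightarrow> nat \<Rightarrow> real ^ 'n" where
  "phase2_y f ell \<delta> R xbar k = fst (phase2 f ell \<delta> R xbar k)"

text \<open>Gradient calls until the algorithm produces an \<open>\<epsilon>\<close>-solution among \<open>y 0, y 1, \<dots>\<close>. Phase 2
  starts at the first gradient descent iterate that meets the stopping criterion of Phase 1 and
  is never entered if there is none. The point \<open>y k\<close> depends on the gradients at
  \<open>y 0, \<dots>, y (k - 1)\<close> only: those at \<open>y 1, \<dots>, y (k - 1)\<close> are shared with the updates of \<open>u\<close>,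
  and the last update of \<open>u\<close> is not needed for \<open>y k\<close>.\<close>

definition alg1_complexity ::
    "(real ^ 'n \<Rightarrow> ereal) \<Rightarrow> (real \<Rightarrow> real) \<Rightarrow> real ^ 'n \<Rightarrow> real ^ 'n \<Rightarrow> real \<Rightarrow> real \<Rightarrow> real \<Rightarrow> enat"
  where
  "alg1_complexity f ell xs x0 \<delta> R \<epsilon> =
     (case k_GD f ell xs x0 \<delta> of
        enat J \<Rightarrow> enat J
          + oracle_complexity f (phase2_y f ell \<delta> R (gd f ell x0 J)) (eps_solution f \<epsilon>)
      | \<infinity> \<Rightarrow> \<infinity>)"


section \<open>The function \<open>\<psi>\<close> and the set \<open>Q\<close>\<close>

definition psi :: "(real \<Rightarrow> real) \<Rightarrow> real \<Rightarrow> real" where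
  "psi ell x = x\<^sup>2 / (2 * ell (4 * x))"

definition Delta_max :: "(real \<Rightarrow> real) \<Rightarrow> ereal" where
  "Delta_max ell = (GREATEST t. strict_mono_on {x. 0 \<le> x \<and> ereal x < t} (psi ell))"

definition psi_Delta_max :: "(real \<Rightarrow> real) \<Rightarrow> ereal" where
  "psi_Delta_max ell =
     (if Delta_max ell = \<infinity> then Lim at_top (\<lambda>x. ereal (psi ell x))
      else ereal (psi ell (real_of_ereal (Delta_max ell))))"

definition Delta_left :: "(real \<Rightarrow> real) \<Rightarrow> real \<Rightarrow> real" where
  "Delta_left ell \<delta> = (THE x. 0 \<le> x \<and> ereal x < Delta_max ell \<and> psi ell x = \<delta>)"

definition Delta_right :: "(real \<Rightarrow> real) \<Rightarrow> real \<Rightarrow> ereal" where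
  "Delta_right ell \<delta> =
     (if \<exists>x. Delta_max ell \<le> ereal x \<and> psi ell x = \<delta>
      then ereal (LEAST x. Delta_max ell \<le> ereal x \<and> psi ell x = \<delta>)
      else \<infinity>)"

text \<open>\<open>\<Delta>\<close> is the initial gap \<open>f x0 - f xs\<close> and \<open>M\<close> the bound on the gradient norms.\<close>

definition Q_set :: "(real \<Rightarrow> real) \<Rightarrow> ereal \<Rightarrow> real \<Rightarrow> real set" where
  "Q_set ell \<Delta> M =
     {\<delta>. 0 \<le> \<delta> \<and> ereal \<delta> \<le> ereal (1 / 2) * psi_Delta_max ell \<and>
         ell (4 * Delta_left ell \<delta>) \<le> 2 * ell 0 \<and>
         Delta_right ell \<delta> \<ge> ereal (2 * M) \<and>
         ereal \<delta> \<le> \<Delta>}"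


section \<open>The complexity bound\<close>

text \<open>Unlike \<^const>\<open>log\<close>, which vanishes at \<open>0\<close>, this takes the value \<open>-\<infinity>\<close> there.\<close>

definition log0 :: "real \<Rightarrow> real \<Rightarrow> ereal" where
  "log0 b x = (if x = 0 then -\<infinity> else ereal (log b x))"

definition k_bound ::
    "(real ^ 'n \<Rightarrow> ereal) \<Rightarrow> (real \<Rightarrow> real) \<Rightarrow> real ^ 'n \<Rightarrow> real ^ 'n \<Rightarrow> real \<Rightarrow> real \<Rightarrow> ereal" where
  "k_bound f ell xs x0 R \<delta> =
     max (1 + ereal (1 / 2) * log0 (3 / 2) (\<delta> / (8 * ell 0 * R\<^sup>2))) 0
       + ereal_of_enat (k_GD f ell xs x0 \<delta>)"

definition ereal_ceiling :: "ereal \<Rightarrow> ereal" where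
  "ereal_ceiling x = (if \<bar>x\<bar> = \<infinity> then x else ereal (of_int \<lceil>real_of_ereal x\<rceil>))"

end

theory Submission
  imports Defs
begin

text \<open>Since \<open>\<psi> (norm (\<nabla>f x)) \<le> f x - f x\<^sup>*\<close>, the two conditions on \<open>\<delta>\<close> confine the gradient at a point
  with gap at most \<open>\<delta>\<close> at distance at most \<open>2 R\<close> from \<open>x\<^sup>*\<close> to a ball of radius \<open>D = \<Delta>_left(\<delta>)\<close>:
  the values between \<open>\<Delta>_left\<close> and \<open>\<Delta>_right\<close> are excluded by the bound on \<open>\<psi>\<close> and the larger ones by \<open>M\<close>.
  Gradient steps of Phase 1 never increase the distance to \<open>x\<^sup>*\<close>, so Phase 2 starts with
  \<open>f y - f x\<^sup>* + \<Gamma>/2 (norm (u - x\<^sup>*))\<^sup>2 \<le> \<Gamma> R\<^sup>2\<close>. An accelerated step from such a state is so short that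
  the gradient changes by at most \<open>3 D\<close>; the gradients on the way are bounded by \<open>4 D\<close>, where
  \<open>\<ell> \<le> 2 \<ell>(0)\<close>, and the classical argument for a \<open>2 \<ell>(0)\<close>-smooth function preserves the
  inequality, with \<open>\<Gamma>\<close> divided by \<open>1 + \<surd>(\<gamma> \<Gamma>)\<close>. In terms of \<open>a = \<surd>(\<gamma> \<Gamma>)\<close> the step reads
  \<open>a \<mapsto> a / \<surd>(1 + a)\<close>, which shrinks \<open>a\<close> by a factor \<open>3/2\<close> as long as \<open>a \<ge> 2\<close> and increases \<open>1/a\<close> by at least
  \<open>1/3\<close> afterwards.\<close>

section \<open>Convex functions with a gradient-dependent bound on the Hessian\<close>

lemma power2_norm_diff_scaleR:
  fixes w z :: "'a::real_inner"
  shows "(norm (w - c *\<^sub>R z))\<^sup>2 = (norm w)\<^sup>2 - 2 * c * (z \<bullet> w) + c\<^sup>2 * (norm z)\<^sup>2"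
  unfolding power2_norm_eq_inner
  by (simp add: inner_diff_left inner_diff_right inner_commute power2_eq_square)

text \<open>In the application \<open>X\<close> is \<open>edom f\<close>, \<open>F\<close> is the
  real part of \<open>f\<close> and \<open>H x\<close> is multiplication by the Hessian.
  \<open>barrier\<close> is the form in which continuity of \<open>f\<close> on the closure
  enters.\<close>

locale generalized_smooth =
  fixes X :: "'a::euclidean_space set" and F :: "'a \<Rightarrow> real" and g :: "'a \<Rightarrow> 'a"
    and H :: "'a \<Rightarrow> 'a \<Rightarrow> 'a" and ell :: "real \<Rightarrow> real"
  assumes open_X: "open X" and convex_X: "convex X" and convex_F: "convex_on X F"
    and gderiv: "x \<in> X \<Longrightarrow> GDERIV F x :> g x"
    and g_deriv: "x \<in> X \<Longrightarrow> (g has_derivative H x) (at x)"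
    and H_bound: "x \<in> X \<Longrightarrow> norm (H x h) \<le> ell (norm (g x)) * norm h"
    and barrier: "z \<in> closure X - X \<Longrightarrow> filterlim F at_top (at z within X)"
    and ell_mono: "mono_on {0..} ell"
    and ell_pos: "s \<ge> 0 \<Longrightarrow> ell s > 0"
begin

section \<open>Restriction to lines and control along segments\<close>

lemma ell_le: "0 \<le> s \<Longrightarrow> s \<le> t \<Longrightarrow> ell s \<le> ell t"
  using ell_mono by (auto simp: mono_on_def)

lemma line_deriv:
  assumes "x + t *\<^sub>R v \<in> X"
  shows "((\<lambda>s. F (x + s *\<^sub>R v)) has_real_derivative (v \<bullet> g (x + t *\<^sub>R v))) (at t)"
proof -
  have "(F has_derivative (\<lambda>h. h \<bullet> g (x + t *\<^sub>R v))) (at (x + t *\<^sub>R v))"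
    using gderiv[OF assms] by (simp add: gderiv_def)
  moreover have "((\<lambda>s. x + s *\<^sub>R v) has_derivative (\<lambda>s. s *\<^sub>R v)) (at t)"
    by (auto intro!: derivative_eq_intros)
  ultimately have "((\<lambda>s. F (x + s *\<^sub>R v)) has_derivative (\<lambda>s. (s *\<^sub>R v) \<bullet> g (x + t *\<^sub>R v))) (at t)"
    using has_derivative_compose by fastforce
  then show ?thesis
    by (simp add: has_field_derivative_def mult.commute[of _ "v \<bullet> _"])
qed

lemma grad_line_deriv:
  assumes "x + t *\<^sub>R v \<in> X"
  shows "((\<lambda>s. g (x + s *\<^sub>R v)) has_derivative (\<lambda>s. H (x + t *\<^sub>R v) (s *\<^sub>R v))) (at t)"
proof -
  have "((\<lambda>s. x + s *\<^sub>R v) has_derivative (\<lambda>s. s *\<^sub>R v)) (at t)"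
    by (auto intro!: derivative_eq_intros)
  then show ?thesis
    using g_deriv[OF assms] by (rule has_derivative_compose)
qed

text \<open>Restriction to the line through \<open>x\<close> and \<open>z\<close> reduces this to
  the one-dimensional \<open>convex_on_imp_above_tangent\<close>. The parameter set \<open>A\<close>
  is the full preimage of \<open>X\<close>, so that \<open>0\<close> is an interior point of
  it.\<close>

lemma above_tangent:
  assumes "x \<in> X" "z \<in> X"
  shows "F z \<ge> F x + g x \<bullet> (z - x)"
proof -
  define A where "A = {t. x + t *\<^sub>R (z - x) \<in> X}"
  have "A = (\<lambda>t. x + t *\<^sub>R (z - x)) -` X" by (auto simp: A_def)
  then have "open A"
    using open_X by (auto intro!: continuous_open_vimage continuous_intros)
  have line: "x + ((1 - u) * s + u * t) *\<^sub>R (z - x)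
      = (1 - u) *\<^sub>R (x + s *\<^sub>R (z - x)) + u *\<^sub>R (x + t *\<^sub>R (z - x))" for s t u :: real
    by (simp add: algebra_simps)
  have "convex A"
    unfolding convex_alt using convexD_alt[OF convex_X] by (auto simp: A_def line)
  then have "convex_on A (\<lambda>t. F (x + t *\<^sub>R (z - x)))"
    using convex_onD[OF convex_F] by (intro convex_onI) (auto simp: A_def line)
  moreover have "0 \<in> interior A" "1 \<in> A"
    using assms \<open>open A\<close> by (auto simp: interior_open A_def)
  moreover have "((\<lambda>s. F (x + s *\<^sub>R (z - x))) has_real_derivative ((z - x) \<bullet> g x)) (at 0 within A)"
    using line_deriv[of x 0 "z - x"] assms(1) has_field_derivative_at_within by auto
  ultimately have "F (x + 1 *\<^sub>R (z - x)) - F (x + 0 *\<^sub>R (z - x)) \<ge> ((z - x) \<bullet> g x) * (1 - 0)"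
    using \<open>convex A\<close> by (intro convex_on_imp_above_tangent[of A]) (auto simp: convex_connected)
  then show ?thesis by (simp add: inner_commute)
qed

text \<open>An endpoint outside \<open>X\<close> would be a boundary point, where
  \<open>barrier\<close> drives \<open>F\<close> to infinity along the segment, against the bound
  \<open>B\<close>.\<close>

lemma segment_not_exit:
  assumes "0 < T" and "v \<noteq> 0" and "\<And>s. 0 \<le> s \<Longrightarrow> s < T \<Longrightarrow> x + s *\<^sub>R v \<in> X"
    and "\<And>s. 0 \<le> s \<Longrightarrow> s < T \<Longrightarrow> F (x + s *\<^sub>R v) \<le> B"
  shows "x + T *\<^sub>R v \<in> X"
proof (rule ccontr)
  assume notX: "x + T *\<^sub>R v \<notin> X"
  have ev: "\<forall>\<^sub>F s in at_left T. 0 \<le> s \<and> s < T"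
    using eventually_at_left_real[OF \<open>0 < T\<close>] by eventually_elim auto
  have lim: "((\<lambda>s. x + s *\<^sub>R v) \<longlongrightarrow> x + T *\<^sub>R v) (at_left T)"
    by (auto intro!: tendsto_intros)
  moreover have evX: "\<forall>\<^sub>F s in at_left T. x + s *\<^sub>R v \<in> X"
    using ev by eventually_elim (use assms in auto)
  ultimately have "x + T *\<^sub>R v \<in> closure X"
    using closure_subset[of X]
    by (intro Lim_in_closed_set[OF closed_closure]) (auto elim: eventually_mono)
  then have "filterlim F at_top (at (x + T *\<^sub>R v) within X)"
    using barrier notX by auto
  moreover have "filterlim (\<lambda>s. x + s *\<^sub>R v) (at (x + T *\<^sub>R v) within X) (at_left T)"
    unfolding filterlim_at using lim evX notX
    by (auto elim!: eventually_mono)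
  ultimately have "filterlim (\<lambda>s. F (x + s *\<^sub>R v)) at_top (at_left T)"
    using filterlim_compose by blast
  then have "\<forall>\<^sub>F s in at_left T. F (x + s *\<^sub>R v) > B"
    by (simp add: filterlim_at_top_dense)
  with ev have "\<forall>\<^sub>F s in at_left T. False"
    by eventually_elim (use assms(4) in force)
  then show False by simp
qed

text \<open>The mean value inequality evaluates the Hessian at an interior parameter, so the bound
  \<open>G\<close> is demanded for \<open>s < T\<close> only. Thus \<open>segment_control\<close>
  can use it at a parameter where the gradient is not yet under control.\<close>

lemma grad_growth:
  assumes "0 \<le> T" and X: "\<And>s. 0 \<le> s \<Longrightarrow> s \<le> T \<Longrightarrow> x + s *\<^sub>R v \<in> X"
    and G: "\<And>s. 0 \<le> s \<Longrightarrow> s < T \<Longrightarrow> norm (g (x + s *\<^sub>R v)) \<le> G"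
  shows "norm (g (x + T *\<^sub>R v) - g x) \<le> ell G * (T * norm v)"
proof (cases "T = 0")
  case False
  then have "0 < T" using \<open>0 \<le> T\<close> by simp
  have "continuous_on {0..T} (\<lambda>s. g (x + s *\<^sub>R v))"
    using grad_line_deriv[OF X]
    by (auto intro!: continuous_at_imp_continuous_on has_derivative_continuous)
  moreover have "((\<lambda>s. g (x + s *\<^sub>R v)) has_derivative (\<lambda>h. H (x + s *\<^sub>R v) (h *\<^sub>R v))) (at s)"
    if "0 < s" "s < T" for s
    using grad_line_deriv[OF X] that by auto
  ultimately obtain s where s: "s \<in> {0<..<T}" and
    "norm (g (x + T *\<^sub>R v) - g (x + 0 *\<^sub>R v)) \<le> norm (H (x + s *\<^sub>R v) ((T - 0) *\<^sub>R v))"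
    using mvt_general[OF \<open>0 < T\<close>, of "\<lambda>s. g (x + s *\<^sub>R v)" "\<lambda>s h. H (x + s *\<^sub>R v) (h *\<^sub>R v)"]
    by auto
  note this(2)
  also have "norm (H (x + s *\<^sub>R v) ((T - 0) *\<^sub>R v)) \<le> ell (norm (g (x + s *\<^sub>R v))) * (T * norm v)"
    using H_bound[OF X, of s "T *\<^sub>R v"] s \<open>0 < T\<close> by auto
  also have "\<dots> \<le> ell G * (T * norm v)"
    using s \<open>0 < T\<close> G by (intro mult_right_mono ell_le) auto
  finally show ?thesis by simp
qed simp

text \<open>A continuation argument at the infimum \<open>T\<close> of the bad parameters. Before
  \<open>T\<close> the gradient is at most \<open>G\<close>, which keeps \<open>F\<close> bounded,
  so the segment is still in \<open>X\<close> at \<open>T\<close>. The Hessian bound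
  \<open>ell G\<close> and \<open>growth\<close> then keep the gradient within \<open>G\<close> at
  \<open>T\<close>, and strictly so if \<open>T < 1\<close>.\<close>

lemma segment_control:
  assumes x: "x \<in> X" and "0 \<le> G" and growth: "norm (g x) + ell G * norm v \<le> G"
    and "0 \<le> s" "s \<le> 1"
  shows "x + s *\<^sub>R v \<in> X" and "norm (g (x + s *\<^sub>R v)) \<le> G"
    and "norm (g (x + s *\<^sub>R v) - g x) \<le> ell G * (s * norm v)"
proof -
  have main: "\<forall>s\<in>{0..1}. x + s *\<^sub>R v \<in> X \<and> norm (g (x + s *\<^sub>R v)) \<le> G"
  proof (cases "v = 0")
    case True
    then show ?thesis using x growth by simp
  next
    case False
    define B where "B = {s\<in>{0..1}. \<not> (x + s *\<^sub>R v \<in> X \<and> norm (g (x + s *\<^sub>R v)) \<le> G)}"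
    have "B = {}"
    proof (rule ccontr)
      assume ne: "B \<noteq> {}"
      define T where "T = Inf B"
      have bdd: "bdd_below B" by (auto simp: B_def intro!: bdd_belowI[of _ 0])
      obtain b where "b \<in> B" using ne by blast
      then have T01: "0 \<le> T" "T \<le> 1"
        using cInf_lower[OF _ bdd, of b] cInf_greatest[OF ne, of 0] by (auto simp: T_def B_def)
      have good: "x + s *\<^sub>R v \<in> X \<and> norm (g (x + s *\<^sub>R v)) \<le> G" if "0 \<le> s" "s < T" for s
      proof -
        have "s \<notin> B" using cInf_lower[OF _ bdd, of s] that by (auto simp: T_def)
        then show ?thesis using that T01 by (auto simp: B_def)
      qed
      \<comment> \<open>The tangent at the moving point, evaluated at \<open>x\<close>, bounds
        \<open>F\<close> at the moving point from above.\<close>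
      have bound: "F (x + s *\<^sub>R v) \<le> F x + G * norm v" if "0 \<le> s" "s < T" for s
      proof -
        have "F x \<ge> F (x + s *\<^sub>R v) + g (x + s *\<^sub>R v) \<bullet> (x - (x + s *\<^sub>R v))"
          using above_tangent[of "x + s *\<^sub>R v" x] good that x by auto
        then have "F (x + s *\<^sub>R v) \<le> F x + s * (g (x + s *\<^sub>R v) \<bullet> v)" by simp
        also have "g (x + s *\<^sub>R v) \<bullet> v \<le> norm (g (x + s *\<^sub>R v)) * norm v"
          by (rule norm_cauchy_schwarz)
        also have "\<dots> \<le> G * norm v"
          using good that by (intro mult_right_mono) auto
        also have "s * (G * norm v) \<le> 1 * (G * norm v)"
          using that T01 \<open>0 \<le> G\<close> by (intro mult_right_mono) auto
        finally show ?thesis using that by (simp add: mult_left_mono)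
      qed
      have TX: "x + T *\<^sub>R v \<in> X"
        using segment_not_exit[of T v x "F x + G * norm v"] False good bound x T01
        by (cases "T = 0") auto
      then have gT: "norm (g (x + T *\<^sub>R v) - g x) \<le> ell G * (T * norm v)"
        using T01 good TX by (intro grad_growth) (metis less_eq_real_def)+
      have gT': "norm (g (x + T *\<^sub>R v)) \<le> norm (g x) + ell G * (T * norm v)"
        using gT norm_triangle_ineq2[of "g (x + T *\<^sub>R v)" "g x"] by linarith
      \<comment> \<open>For \<open>T < 1\<close> the strict bound extends to a neighbourhood of
        \<open>T\<close>, so \<open>B\<close> keeps a distance \<open>d\<close> from its infimum.
        For \<open>T = 1\<close> the only candidate in \<open>B\<close> is \<open>1\<close> itself,
        where the non-strict bound suffices.\<close>
      show False
      proof (cases "T < 1")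
        case True
        have "ell G * (T * norm v) < ell G * norm v"
          using True False ell_pos[OF \<open>0 \<le> G\<close>] by simp
        then have "norm (g (x + T *\<^sub>R v)) < G" using gT' growth by linarith
        moreover have "isCont (\<lambda>s. g (x + s *\<^sub>R v)) T"
          by (rule has_derivative_continuous[OF grad_line_deriv[OF TX]])
        then have "((\<lambda>s. norm (g (x + s *\<^sub>R v))) \<longlongrightarrow> norm (g (x + T *\<^sub>R v))) (at T)"
          unfolding isCont_def by (rule tendsto_norm)
        ultimately have "\<forall>\<^sub>F s in at T. norm (g (x + s *\<^sub>R v)) < G"
          by (rule order_tendstoD(2)[rotated])
        moreover have "\<forall>\<^sub>F s in at T. x + s *\<^sub>R v \<in> X"
          by (rule topological_tendstoD[OF _ open_X TX]) (auto intro!: tendsto_intros)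
        ultimately have "\<forall>\<^sub>F s in at T. x + s *\<^sub>R v \<in> X \<and> norm (g (x + s *\<^sub>R v)) < G"
          by eventually_elim auto
        then obtain d where "d > 0"
          and d: "\<And>s. s \<noteq> T \<Longrightarrow> dist s T < d \<Longrightarrow> x + s *\<^sub>R v \<in> X \<and> norm (g (x + s *\<^sub>R v)) < G"
          by (auto simp: eventually_at)
        have "T \<notin> B" using TX \<open>norm (g (x + T *\<^sub>R v)) < G\<close> by (simp add: B_def)
        have "T + d \<le> s" if "s \<in> B" for s
        proof -
          have "T \<le> s" using cInf_lower[OF that bdd] by (simp add: T_def)
          moreover have "s \<noteq> T" using that \<open>T \<notin> B\<close> by blast
          moreover have "\<not> dist s T < d" using d[OF \<open>s \<noteq> T\<close>] that by (auto simp: B_def)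
          ultimately show ?thesis by (simp add: dist_real_def)
        qed
        then have "T + d \<le> T" unfolding T_def using ne by (intro cInf_greatest) (auto simp: T_def)
        then show False using \<open>d > 0\<close> by simp
      next
        case T1: False
        then have "T = 1" using T01 by linarith
        have "1 \<le> b" using cInf_lower[OF \<open>b \<in> B\<close> bdd] \<open>T = 1\<close> unfolding T_def by linarith
        then have "b = 1" using \<open>b \<in> B\<close> unfolding B_def by auto
        then have "1 \<in> B" using \<open>b \<in> B\<close> by blast
        then show False using TX gT' growth unfolding \<open>T = 1\<close> by (simp add: B_def)
      qed
    qed
    then show ?thesis by (auto simp: B_def)
  qed
  show "x + s *\<^sub>R v \<in> X" "norm (g (x + s *\<^sub>R v)) \<le> G" using main assms by auto
  show "norm (g (x + s *\<^sub>R v) - g x) \<le> ell G * (s * norm v)"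
    using main assms by (intro grad_growth) auto
qed

section \<open>Quadratic upper bound and cocoercivity\<close>

lemma descent:
  assumes x: "x \<in> X" and "0 \<le> G" and "norm (g x) + ell G * norm v \<le> G"
  shows "F (x + v) \<le> F x + g x \<bullet> v + ell G / 2 * (norm v)\<^sup>2"
proof -
  \<comment> \<open>Up to the constant \<open>F x\<close>, this is the difference between
    \<open>F\<close> and its quadratic model along the segment.\<close>
  define \<phi> where "\<phi> s = F (x + s *\<^sub>R v) - s * (g x \<bullet> v) - ell G / 2 * s\<^sup>2 * (norm v)\<^sup>2" for s
  have "\<phi> 1 \<le> \<phi> 0"
  proof (rule DERIV_nonpos_imp_nonincreasing[of 0 1])
    fix s :: real assume s: "0 \<le> s" "s \<le> 1"
    note c = segment_control[OF assms s]
    have "(\<phi> has_real_derivative v \<bullet> g (x + s *\<^sub>R v) - g x \<bullet> v - ell G * s * (norm v)\<^sup>2) (at s)"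
      unfolding \<phi>_def by (rule derivative_eq_intros line_deriv[OF c(1)] refl)+ simp
    moreover have "v \<bullet> g (x + s *\<^sub>R v) - g x \<bullet> v - ell G * s * (norm v)\<^sup>2 \<le> 0"
    proof -
      have "v \<bullet> g (x + s *\<^sub>R v) - g x \<bullet> v = (g (x + s *\<^sub>R v) - g x) \<bullet> v"
        by (simp add: inner_diff_left inner_commute[of v])
      also have "\<dots> \<le> norm (g (x + s *\<^sub>R v) - g x) * norm v" by (rule norm_cauchy_schwarz)
      also have "\<dots> \<le> ell G * (s * norm v) * norm v"
        by (rule mult_right_mono[OF c(3)]) simp
      finally show ?thesis by (simp add: power2_eq_square mult_ac)
    qed
    ultimately show "\<exists>y. (\<phi> has_real_derivative y) (at s) \<and> y \<le> 0" by blast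
  qed simp
  then show ?thesis by (simp add: \<phi>_def)
qed

text \<open>Minimise the quadratic upper model at \<open>y\<close> of the function \<open>z \<mapsto> F z - g y' \<bullet> z\<close>, whose
  minimiser is \<open>y'\<close>.\<close>

lemma cocoercive:
  assumes y: "y \<in> X" and y': "y' \<in> X" and G: "norm (g y) + norm (g y - g y') \<le> G" and "ell G \<le> L"
  shows "F y \<ge> F y' + g y' \<bullet> (y - y') + 1 / (2 * L) * (norm (g y - g y'))\<^sup>2"
proof -
  define p where "p = g y - g y'"
  have "0 \<le> G" using G norm_ge_zero[of "g y"] norm_ge_zero[of "g y - g y'"] by linarith
  then have "0 < L" using ell_pos[of G] \<open>ell G \<le> L\<close> by simp
  define v where "v = - (1 / L) *\<^sub>R p"
  \<comment> \<open>The step has length \<open>norm p / L\<close>, so along it the gradient changes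
    by at most \<open>norm p\<close>, which is the room that \<open>G\<close> provides.\<close>
  have "ell G * norm v \<le> L * norm v"
    using \<open>ell G \<le> L\<close> by (intro mult_right_mono) auto
  also have "\<dots> = norm p" using \<open>0 < L\<close> by (simp add: v_def)
  finally have c: "norm (g y) + ell G * norm v \<le> G" using G by (simp add: p_def)
  have "y + v \<in> X" using segment_control(1)[OF y \<open>0 \<le> G\<close> c, of 1] by simp
  then have "F y' + g y' \<bullet> (y + v - y') \<le> F (y + v)" by (rule above_tangent[OF y'])
  also have "\<dots> \<le> F y + g y \<bullet> v + ell G / 2 * (norm v)\<^sup>2" by (rule descent[OF y \<open>0 \<le> G\<close> c])
  also have "\<dots> \<le> F y + g y \<bullet> v + L / 2 * (norm v)\<^sup>2"
    using \<open>ell G \<le> L\<close> by (simp add: mult_right_mono)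
  finally have "F y' + g y' \<bullet> (y - y') \<le> F y + p \<bullet> v + L / 2 * (norm v)\<^sup>2"
    by (simp add: p_def inner_simps)
  moreover have "p \<bullet> v = - (norm p)\<^sup>2 / L" by (simp add: v_def dot_square_norm)
  moreover have "L / 2 * (norm v)\<^sup>2 = (norm p)\<^sup>2 / (2 * L)"
    using \<open>0 < L\<close> by (simp add: v_def power_mult_distrib power_divide power2_eq_square)
  moreover have "(norm p)\<^sup>2 / L = 2 * ((norm p)\<^sup>2 / (2 * L))" by simp
  moreover have "1 / (2 * L) * (norm p)\<^sup>2 = (norm p)\<^sup>2 / (2 * L)" by simp
  ultimately show ?thesis unfolding p_def[symmetric] by linarith
qed

section \<open>Estimates relative to a minimiser\<close>

context
  fixes xs assumes xs: "xs \<in> X" and xs_min: "\<And>x. x \<in> X \<Longrightarrow> F xs \<le> F x"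
begin

lemma grad_minimizer: "g xs = 0"
proof -
  have "(F has_derivative (\<lambda>h. h \<bullet> g xs)) (at xs)"
    using gderiv[OF xs] by (simp add: gderiv_def)
  then have "(\<lambda>h. h \<bullet> g xs) = (\<lambda>h. 0)"
    by (rule differential_zero_maxmin[OF xs open_X]) (use xs_min in blast)
  then have "g xs \<bullet> g xs = 0" by (rule fun_cong)
  then show ?thesis by simp
qed

text \<open>A gradient step of size \<open>1 / L\<close> with
  \<open>L = ell (4 * norm (g x))\<close> changes the gradient by at most \<open>norm (g x)\<close>,
  hence stays within the radius \<open>4 * norm (g x)\<close>. It lowers \<open>F\<close> by at
  least \<psi> of the gradient norm, and \<open>F\<close> cannot fall below
  \<open>F xs\<close>.\<close>

lemma gap_ge_psi:
  assumes x: "x \<in> X"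
  shows "psi ell (norm (g x)) \<le> F x - F xs"
proof -
  define L where "L = ell (4 * norm (g x))"
  have "0 < L" using ell_pos[of "4 * norm (g x)"] by (simp add: L_def)
  define v where "v = - (1 / L) *\<^sub>R g x"
  have v: "norm v = norm (g x) / L" using \<open>0 < L\<close> by (simp add: v_def)
  have c: "norm (g x) + ell (4 * norm (g x)) * norm v \<le> 4 * norm (g x)"
    using \<open>0 < L\<close> by (simp add: v flip: L_def)
  have "x + v \<in> X" using segment_control(1)[OF x _ c, of 1] by simp
  then have "F xs \<le> F (x + v)" by (rule xs_min)
  also have "\<dots> \<le> F x + g x \<bullet> v + L / 2 * (norm v)\<^sup>2" using descent[OF x _ c] by (simp add: L_def)
  also have "L / 2 * (norm v)\<^sup>2 = (norm (g x))\<^sup>2 / L - psi ell (norm (g x))"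
    using \<open>0 < L\<close> by (simp add: v psi_def power_divide power2_eq_square flip: L_def)
  also have "g x \<bullet> v = - (norm (g x))\<^sup>2 / L"
    by (simp add: v_def dot_square_norm)
  finally show ?thesis by simp
qed

text \<open>Cocoercivity is applied with \<open>xs\<close> as the point where the step starts. The
  gradient vanishes there, so the radius is \<open>norm (g x)\<close> itself and the constant is
  \<open>ell (norm (g x))\<close>, which matches the allowed stepsize.\<close>

lemma grad_step_nonexpansive:
  assumes x: "x \<in> X" and "0 \<le> \<eta>" "\<eta> \<le> 1 / ell (norm (g x))"
  shows "norm (x - \<eta> *\<^sub>R g x - xs) \<le> norm (x - xs)"
proof -
  define L where "L = ell (norm (g x))"
  have "F xs \<ge> F x + g x \<bullet> (xs - x) + 1 / (2 * L) * (norm (g xs - g x))\<^sup>2"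
    by (rule cocoercive[OF xs x, of "norm (g x)"]) (simp_all add: grad_minimizer L_def)
  then have "1 / L * (norm (g x))\<^sup>2 \<le> 2 * (g x \<bullet> (x - xs))"
    using xs_min[OF x] by (simp add: grad_minimizer inner_diff_right)
  moreover have "\<eta> * (norm (g x))\<^sup>2 \<le> 1 / L * (norm (g x))\<^sup>2"
    using assms by (intro mult_right_mono) (auto simp: L_def)
  ultimately have "\<eta> * (\<eta> * (norm (g x))\<^sup>2) \<le> \<eta> * (2 * (g x \<bullet> (x - xs)))"
    using \<open>0 \<le> \<eta>\<close> by (intro mult_left_mono) auto
  moreover have "(norm (x - xs - \<eta> *\<^sub>R g x))\<^sup>2
      = (norm (x - xs))\<^sup>2 - \<eta> * (2 * (g x \<bullet> (x - xs))) + \<eta> * (\<eta> * (norm (g x))\<^sup>2)"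
    unfolding power2_norm_diff_scaleR by (simp add: power2_eq_square)
  ultimately have "(norm (x - xs - \<eta> *\<^sub>R g x))\<^sup>2 \<le> (norm (x - xs))\<^sup>2" by linarith
  then have "norm (x - xs - \<eta> *\<^sub>R g x) \<le> norm (x - xs)" by (rule power2_le_imp_le) simp
  moreover have "x - \<eta> *\<^sub>R g x - xs = x - xs - \<eta> *\<^sub>R g x" by (simp add: algebra_simps)
  ultimately show ?thesis by (rule back_subst[of "\<lambda>z. norm z \<le> norm (x - xs)", OF _ sym])
qed

text \<open>The energy is the Lyapunov function of the accelerated method. Of the projection only
  one property enters, in \<open>u'\<close>: it does not increase the distance to \<open>xs\<close>.
  The distance bound on \<open>y\<close> is carried along because the energy controls
  \<open>u\<close> but not \<open>y\<close>.\<close>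

lemma accelerated_step:
  assumes y: "y \<in> X" and "0 < D" and gD: "norm (g y) \<le> D" and ellD: "ell (4 * D) \<le> 2 * ell 0"
    and "0 < \<Gamma>" and "0 \<le> R" and \<Gamma>R: "\<Gamma> * R\<^sup>2 \<le> psi ell D"
    and energy: "F y - F xs + \<Gamma> / 2 * (norm (u - xs))\<^sup>2 \<le> \<Gamma> * R\<^sup>2"
    and yR: "norm (y - xs) \<le> sqrt 2 * R"
    and \<gamma>: "\<gamma> = 1 / (2 * ell 0)" and \<alpha>: "\<alpha> = sqrt (\<gamma> * \<Gamma>)"
    and y': "y' = (1 / (1 + \<alpha>)) *\<^sub>R y + (\<alpha> / (1 + \<alpha>)) *\<^sub>R u - (\<gamma> / (1 + \<alpha>)) *\<^sub>R g y"
    and u': "norm (u' - xs) \<le> norm (u - (\<alpha> / \<Gamma>) *\<^sub>R g y' - xs)"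
  shows "y' \<in> X"
    and "F y' - F xs + \<Gamma> / (1 + \<alpha>) / 2 * (norm (u' - xs))\<^sup>2 \<le> \<Gamma> / (1 + \<alpha>) * R\<^sup>2"
    and "norm (y' - xs) \<le> sqrt 2 * R"
proof -
  define K where "K = ell (4 * D)"
  have "0 < ell 0" by (simp add: ell_pos)
  then have "0 < \<gamma>" by (simp add: \<gamma>)
  then have "0 < \<alpha>" and \<alpha>2: "\<alpha>\<^sup>2 = \<gamma> * \<Gamma>" using \<open>0 < \<Gamma>\<close> by (simp_all add: \<alpha>)
  have "0 < K" using ell_pos[of "4 * D"] \<open>0 < D\<close> by (simp add: K_def)
  have K\<gamma>: "K * \<gamma> \<le> 1" using ellD \<open>0 < ell 0\<close> by (simp add: \<gamma> K_def)
  \<comment> \<open>Dropping the nonnegative gap from the energy puts \<open>u\<close> within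
    \<open>sqrt 2 * R\<close> of \<open>xs\<close>; together with \<open>yR\<close> this gives the
    factor 8 in \<open>uy\<close>.\<close>
  have "\<Gamma> / 2 * (norm (u - xs))\<^sup>2 \<le> \<Gamma> / 2 * (2 * R\<^sup>2)" using energy xs_min[OF y] by simp
  then have u2: "(norm (u - xs))\<^sup>2 \<le> 2 * R\<^sup>2" using \<open>0 < \<Gamma>\<close> by simp
  then have "(norm (u - xs))\<^sup>2 \<le> (sqrt 2 * R)\<^sup>2" by (simp add: power_mult_distrib)
  then have uR: "norm (u - xs) \<le> sqrt 2 * R"
    by (rule power2_le_imp_le) (simp add: \<open>0 \<le> R\<close>)
  have y'eq: "(1 + \<alpha>) *\<^sub>R y' = y + \<alpha> *\<^sub>R u - \<gamma> *\<^sub>R g y"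
    using \<open>0 < \<alpha>\<close> by (simp add: y' scaleR_diff_right scaleR_add_right)

  define v where "v = y' - y"
  have v: "(1 + \<alpha>) *\<^sub>R v = \<alpha> *\<^sub>R (u - y) - \<gamma> *\<^sub>R g y"
    unfolding v_def scaleR_diff_right y'eq by (simp add: algebra_simps)
  have "norm (u - y) \<le> 2 * sqrt 2 * R"
    using norm_triangle_ineq4[of "u - xs" "y - xs"] uR yR by simp
  then have "(norm (u - y))\<^sup>2 \<le> (2 * sqrt 2 * R)\<^sup>2" by (rule power_mono) simp
  then have uy: "(norm (u - y))\<^sup>2 \<le> 8 * R\<^sup>2" by (simp add: power_mult_distrib)
  \<comment> \<open>Since \<open>psi ell D\<close> is \<open>D\<^sup>2 / (2 * K)\<close>, the factor
    8 becomes \<open>4 * D\<^sup>2\<close> times \<open>K * \<gamma>\<close>, and the latter is at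
    most 1.\<close>
  have "(K * (\<alpha> * norm (u - y)))\<^sup>2 = K\<^sup>2 * \<gamma> * \<Gamma> * (norm (u - y))\<^sup>2"
    by (simp add: power_mult_distrib \<alpha>2)
  also have "\<dots> \<le> K\<^sup>2 * \<gamma> * \<Gamma> * (8 * R\<^sup>2)"
    using uy \<open>0 < \<gamma>\<close> \<open>0 < \<Gamma>\<close> by (intro mult_left_mono) auto
  also have "\<dots> = 8 * K\<^sup>2 * \<gamma> * (\<Gamma> * R\<^sup>2)" by simp
  also have "\<dots> \<le> 8 * K\<^sup>2 * \<gamma> * psi ell D"
    using \<Gamma>R \<open>0 < \<gamma>\<close> by (intro mult_left_mono) auto
  also have "\<dots> = (K * \<gamma>) * (2 * D)\<^sup>2"
    using \<open>0 < K\<close> by (simp add: psi_def power2_eq_square flip: K_def)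
  also have "\<dots> \<le> 1 * (2 * D)\<^sup>2" by (intro mult_right_mono K\<gamma>) simp
  finally have "(K * (\<alpha> * norm (u - y)))\<^sup>2 \<le> (2 * D)\<^sup>2" by simp
  then have n1: "K * (\<alpha> * norm (u - y)) \<le> 2 * D"
    by (rule power2_le_imp_le) (simp add: \<open>0 < D\<close> less_imp_le)
  have "K * (\<gamma> * norm (g y)) = (K * \<gamma>) * norm (g y)" by simp
  also have "\<dots> \<le> 1 * D" using K\<gamma> gD \<open>0 < K\<close> \<open>0 < \<gamma>\<close> by (intro mult_mono) auto
  finally have n2: "K * (\<gamma> * norm (g y)) \<le> D" by simp
  have "norm v \<le> (1 + \<alpha>) * norm v" using \<open>0 < \<alpha>\<close> by (simp add: algebra_simps)
  also have "\<dots> = norm (\<alpha> *\<^sub>R (u - y) - \<gamma> *\<^sub>R g y)"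
    using \<open>0 < \<alpha>\<close> unfolding v[symmetric] by simp
  also have "\<dots> \<le> \<alpha> * norm (u - y) + \<gamma> * norm (g y)"
    using norm_triangle_ineq4[of "\<alpha> *\<^sub>R (u - y)" "\<gamma> *\<^sub>R g y"] \<open>0 < \<alpha>\<close> \<open>0 < \<gamma>\<close> by simp
  finally have "K * norm v \<le> K * (\<alpha> * norm (u - y) + \<gamma> * norm (g y))"
    using \<open>0 < K\<close> by simp
  then have n3: "K * norm v \<le> 3 * D" using n1 n2 by (simp add: distrib_left)
  then have c: "norm (g y) + ell (4 * D) * norm v \<le> 4 * D" using gD by (simp add: K_def)
  have "0 \<le> 4 * D" using \<open>0 < D\<close> by simp
  note sc = segment_control[OF y this c, of 1]
  show y'X: "y' \<in> X" using sc(1) by (simp add: v_def)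
  have gg: "norm (g y - g y') \<le> 3 * D"
    using sc(3) n3 by (simp add: v_def K_def norm_minus_commute)

  \<comment> \<open>The radius for cocoercivity is \<open>D + 3 * D\<close>, and its constant
    \<open>2 * ell 0\<close> is the inverse of \<gamma>.\<close>
  have "F y \<ge> F y' + g y' \<bullet> (y - y') + \<gamma> / 2 * (norm (g y - g y'))\<^sup>2"
    using cocoercive[OF y y'X _ ellD] gg gD by (simp add: \<gamma>)
  moreover have "\<alpha> * F xs \<ge> \<alpha> * (F y' + g y' \<bullet> (xs - y'))"
    using above_tangent[OF y'X xs] \<open>0 < \<alpha>\<close> by (intro mult_left_mono) auto
  \<comment> \<open>The weights of \<open>y'\<close> are chosen for this identity: its term
    \<open>\<gamma> * (g y' \<bullet> g y)\<close> cancels the mixed term of the squared gradient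
    difference.\<close>
  moreover have "g y' \<bullet> (y - y') + \<alpha> * (g y' \<bullet> (xs - y')) = \<gamma> * (g y' \<bullet> g y) - \<alpha> * (g y' \<bullet> (u - xs))"
  proof -
    have "g y' \<bullet> (y - y') + \<alpha> * (g y' \<bullet> (xs - y')) = g y' \<bullet> (y + \<alpha> *\<^sub>R xs - (1 + \<alpha>) *\<^sub>R y')"
      by (simp add: inner_simps algebra_simps)
    then show ?thesis unfolding y'eq by (simp add: inner_simps algebra_simps)
  qed
  moreover have "(norm (g y - g y'))\<^sup>2 = (norm (g y))\<^sup>2 - 2 * (g y' \<bullet> g y) + (norm (g y'))\<^sup>2"
    using power2_norm_diff_scaleR[of "g y" 1 "g y'"] by simp
  ultimately have F: "(1 + \<alpha>) * (F y' - F xs)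
      \<le> F y - F xs + \<alpha> * (g y' \<bullet> (u - xs)) - \<gamma> / 2 * (norm (g y))\<^sup>2 - \<gamma> / 2 * (norm (g y'))\<^sup>2"
    by (simp add: algebra_simps)
  \<comment> \<open>The step of \<open>u\<close> costs
    \<open>\<alpha>\<^sup>2 / \<Gamma> / 2\<close> times the squared norm of \<open>g y'\<close>. By
    the choice of \<alpha> this is \<open>\<gamma> / 2\<close> times it, which the last term of
    \<open>F\<close> pays for.\<close>
  have "(norm (u' - xs))\<^sup>2 \<le> (norm (u - xs - (\<alpha> / \<Gamma>) *\<^sub>R g y'))\<^sup>2"
    using u' by (intro power_mono) (auto simp: algebra_simps)
  also have "\<dots> = (norm (u - xs))\<^sup>2 - 2 * (\<alpha> / \<Gamma>) * (g y' \<bullet> (u - xs)) + (\<alpha> / \<Gamma>)\<^sup>2 * (norm (g y'))\<^sup>2"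
    by (rule power2_norm_diff_scaleR)
  finally have "\<Gamma> / 2 * (norm (u' - xs))\<^sup>2 \<le> \<Gamma> / 2 * \<dots>"
    using \<open>0 < \<Gamma>\<close> by (intro mult_left_mono) auto
  also have "\<dots> = \<Gamma> / 2 * (norm (u - xs))\<^sup>2 - \<alpha> * (g y' \<bullet> (u - xs)) + \<alpha>\<^sup>2 / \<Gamma> / 2 * (norm (g y'))\<^sup>2"
    using \<open>0 < \<Gamma>\<close> by (simp add: power2_eq_square field_simps)
  also have "\<alpha>\<^sup>2 / \<Gamma> = \<gamma>" using \<open>0 < \<Gamma>\<close> by (simp add: \<alpha>2)
  finally have "(1 + \<alpha>) * (F y' - F xs) + \<Gamma> / 2 * (norm (u' - xs))\<^sup>2
      \<le> F y - F xs + \<Gamma> / 2 * (norm (u - xs))\<^sup>2 - \<gamma> / 2 * (norm (g y))\<^sup>2"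
    using F by linarith
  also have "\<dots> \<le> F y - F xs + \<Gamma> / 2 * (norm (u - xs))\<^sup>2" using \<open>0 < \<gamma>\<close> by simp
  also note energy
  finally have "((1 + \<alpha>) * (F y' - F xs) + \<Gamma> / 2 * (norm (u' - xs))\<^sup>2) / (1 + \<alpha>) \<le> \<Gamma> * R\<^sup>2 / (1 + \<alpha>)"
    using \<open>0 < \<alpha>\<close> by (intro divide_right_mono) auto
  then show "F y' - F xs + \<Gamma> / (1 + \<alpha>) / 2 * (norm (u' - xs))\<^sup>2 \<le> \<Gamma> / (1 + \<alpha>) * R\<^sup>2"
    using \<open>0 < \<alpha>\<close> by (simp add: add_divide_distrib mult.commute)

  \<comment> \<open>\<open>y'\<close> is a convex combination of \<open>u\<close> and the gradient
    step from \<open>y\<close>, both within \<open>sqrt 2 * R\<close> of \<open>xs\<close>.\<close>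
  have "ell (norm (g y)) \<le> 2 * ell 0"
    using ell_le[of "norm (g y)" "4 * D"] gD ellD \<open>0 < D\<close> by simp
  then have "\<gamma> \<le> 1 / ell (norm (g y))"
    unfolding \<gamma> using ell_pos[of "norm (g y)"] by (intro divide_left_mono) auto
  then have "norm (y - \<gamma> *\<^sub>R g y - xs) \<le> sqrt 2 * R"
    using grad_step_nonexpansive[OF y, of \<gamma>] \<open>0 < \<gamma>\<close> yR by simp
  moreover have "(1 + \<alpha>) *\<^sub>R (y' - xs) = (y - \<gamma> *\<^sub>R g y - xs) + \<alpha> *\<^sub>R (u - xs)"
    unfolding scaleR_diff_right y'eq by (simp add: algebra_simps)
  then have "(1 + \<alpha>) * norm (y' - xs) = norm ((y - \<gamma> *\<^sub>R g y - xs) + \<alpha> *\<^sub>R (u - xs))"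
    using \<open>0 < \<alpha>\<close> by (metis abs_of_pos add_pos_pos norm_scaleR zero_less_one)
  then have "(1 + \<alpha>) * norm (y' - xs) \<le> norm (y - \<gamma> *\<^sub>R g y - xs) + \<alpha> * norm (u - xs)"
    using norm_triangle_ineq[of "y - \<gamma> *\<^sub>R g y - xs" "\<alpha> *\<^sub>R (u - xs)"] \<open>0 < \<alpha>\<close> by simp
  moreover have "\<alpha> * norm (u - xs) \<le> \<alpha> * (sqrt 2 * R)" using uR \<open>0 < \<alpha>\<close> by simp
  ultimately have "(1 + \<alpha>) * norm (y' - xs) \<le> (1 + \<alpha>) * (sqrt 2 * R)"
    by (simp add: algebra_simps)
  then show "norm (y' - xs) \<le> sqrt 2 * R" using \<open>0 < \<alpha>\<close> by simp
qed

end

end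

section \<open>The function \<open>\<psi>\<close>\<close>

lemma locally_lipschitz_on_imp_continuous_on:
  assumes "locally_lipschitz_on S h"
  shows "continuous_on S h"
  unfolding continuous_on_eq_continuous_within
proof
  fix s assume "s \<in> S"
  then obtain u L where "u > 0" and L: "L-lipschitz_on (cball s u \<inter> S) h"
    using assms unfolding locally_lipschitz_on_def by blast
  have "continuous_on (cball s u \<inter> S) h" by (rule lipschitz_on_continuous_on[OF L])
  then have "continuous (at s within cball s u \<inter> S) h"
    using \<open>s \<in> S\<close> \<open>u > 0\<close> by (simp add: continuous_on_eq_continuous_within)
  moreover have "at s within cball s u \<inter> S = at s within S"
    using \<open>u > 0\<close> by (intro at_within_nhd[of s "ball s u"]) auto
  ultimately show "continuous (at s within S) h" by (simp add: continuous_within)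
qed

lemma continuous_on_psi:
  assumes "continuous_on {0..} ell" and "\<And>s. s \<ge> 0 \<Longrightarrow> ell s > 0"
  shows "continuous_on {0..} (psi ell)"
proof -
  have "continuous_on {0..} (\<lambda>x. ell (4 * x))"
    by (rule continuous_on_compose2[OF assms(1)]) (auto intro!: continuous_intros)
  moreover have "2 * ell (4 * x) \<noteq> 0" if "x \<in> {0..}" for x
    using assms(2)[of "4 * x"] that by simp
  ultimately have "continuous_on {0..} (\<lambda>x. x\<^sup>2 / (2 * ell (4 * x)))"
    by (intro continuous_on_divide continuous_on_mult continuous_on_power continuous_on_id
        continuous_on_const) auto
  then show ?thesis by (simp add: psi_def[abs_def])
qed

text \<open>Two points below the supremum are below one common admissible threshold. Hence the
  supremum is itself admissible, and the \<open>GREATEST\<close> in \<open>Delta_max\<close>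
  exists.\<close>

lemma strict_mono_on_below_Sup:
  fixes h :: "real \<Rightarrow> real"
  defines "T \<equiv> {t. strict_mono_on {x. 0 \<le> x \<and> ereal x < t} h}"
  shows "strict_mono_on {x. 0 \<le> x \<and> ereal x < Sup T} h"
proof (rule strict_mono_onI)
  fix x y assume xy: "x \<in> {x. 0 \<le> x \<and> ereal x < Sup T}" "y \<in> {x. 0 \<le> x \<and> ereal x < Sup T}" "x < y"
  then obtain t where t: "t \<in> T" "ereal y < t" by (auto simp: less_Sup_iff)
  moreover have "ereal x < t" using xy(3) t(2) by (meson ereal_less_eq(3) less_imp_le order_le_less_trans)
  ultimately show "h x < h y"
    using xy by (auto simp: T_def elim!: strict_mono_onD)
qed

lemma Delta_max_eq_Sup: "Delta_max ell = Sup {t. strict_mono_on {x. 0 \<le> x \<and> ereal x < t} (psi ell)}"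
  unfolding Delta_max_def
  by (rule Greatest_equality) (auto intro: strict_mono_on_below_Sup Sup_upper)

lemma strict_mono_on_Delta_max: "strict_mono_on {x. 0 \<le> x \<and> ereal x < Delta_max ell} (psi ell)"
  unfolding Delta_max_eq_Sup by (rule strict_mono_on_below_Sup)

lemma Delta_max_nonneg: "Delta_max ell \<ge> 0"
  unfolding Delta_max_eq_Sup
proof (rule Sup_upper)
  have "{x. 0 \<le> x \<and> ereal x < 0} = {}" by auto
  then show "0 \<in> {t. strict_mono_on {x. 0 \<le> x \<and> ereal x < t} (psi ell)}"
    by (simp add: strict_mono_on_def)
qed

text \<open>Treats both readings of \<open>psi_Delta_max\<close> at once. If
  \<open>Delta_max\<close> is infinite, \<psi> increases and its limit is its supremum; otherwise
  the witness is \<open>Delta_max\<close> itself, whence the non-strict inequality.\<close>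

lemma psi_exceeds_below_psi_Delta_max:
  assumes "0 \<le> c" and "ereal c < psi_Delta_max ell"
  obtains x where "0 \<le> x" "ereal x \<le> Delta_max ell" "c < psi ell x"
proof (cases "Delta_max ell = \<infinity>")
  case True
  define L where "L = (SUP x\<in>{0..}. ereal (psi ell x))"
  have mono: "psi ell x < psi ell y" if "0 \<le> x" "x < y" for x y
    using that by (intro strict_mono_onD[OF strict_mono_on_Delta_max]) (auto simp: True)
  have "((\<lambda>x. ereal (psi ell x)) \<longlongrightarrow> L) at_top"
  proof (rule increasing_tendsto)
    show "\<forall>\<^sub>F x in at_top. ereal (psi ell x) \<le> L"
      using eventually_ge_at_top[of 0]
      by eventually_elim (auto simp: L_def intro: SUP_upper)
    fix b assume "b < L"
    then obtain x where x: "0 \<le> x" "b < ereal (psi ell x)"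
      by (auto simp: L_def less_SUP_iff)
    show "\<forall>\<^sub>F y in at_top. b < ereal (psi ell y)"
      using eventually_gt_at_top[of x]
    proof eventually_elim
      case (elim y)
      have "ereal (psi ell x) \<le> ereal (psi ell y)" using mono[OF x(1) elim] by simp
      then show ?case using x(2) by (rule order.strict_trans2[rotated])
    qed
  qed
  then have "psi_Delta_max ell = L"
    using True by (simp add: psi_Delta_max_def tendsto_Lim)
  then obtain x where "0 \<le> x" "c < psi ell x"
    using assms(2) by (auto simp: L_def less_SUP_iff)
  then show ?thesis using that True by simp
next
  case False
  then obtain d where "Delta_max ell = ereal d" "0 \<le> d"
    using Delta_max_nonneg[of ell] by (cases "Delta_max ell") auto
  then show ?thesis using that[of d] assms(2) by (simp add: psi_Delta_max_def)
qed

section \<open>The solutions of \<open>psi ell x = \<delta>\<close> on either side of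
  \<open>Delta_max\<close>\<close>

lemma Delta_left_props:
  assumes cont: "continuous_on {0..} (psi ell)" and "0 < \<delta>" "ereal \<delta> < psi_Delta_max ell"
  shows "0 < Delta_left ell \<delta>" "ereal (Delta_left ell \<delta>) < Delta_max ell"
    "psi ell (Delta_left ell \<delta>) = \<delta>"
proof -
  obtain b where b: "0 \<le> b" "ereal b \<le> Delta_max ell" "\<delta> < psi ell b"
    using psi_exceeds_below_psi_Delta_max[of \<delta> ell] assms by auto
  have "continuous_on {0..b} (psi ell)" by (rule continuous_on_subset[OF cont]) auto
  then obtain x where x: "0 \<le> x" "x \<le> b" "psi ell x = \<delta>"
    using IVT'[of "psi ell" 0 \<delta> b] b \<open>0 < \<delta>\<close> by (auto simp: psi_def)
  \<comment> \<open>Strictness matters, since \<open>b\<close> may equal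
    \<open>Delta_max\<close>.\<close>
  then have "x < b" using b(3) by (cases "x = b") auto
  then have "ereal x < Delta_max ell" using b(2) by (meson less_ereal.simps(1) order_less_le_trans)
  have eq: "Delta_left ell \<delta> = x"
    unfolding Delta_left_def
  proof (rule the_equality)
    fix z assume "0 \<le> z \<and> ereal z < Delta_max ell \<and> psi ell z = \<delta>"
    then show "z = x"
      using strict_mono_on_imp_inj_on[OF strict_mono_on_Delta_max, of ell] x \<open>ereal x < Delta_max ell\<close>
      by (auto dest: inj_onD)
  qed (use x \<open>ereal x < Delta_max ell\<close> in auto)
  have "x \<noteq> 0" using x(3) \<open>0 < \<delta>\<close> by (auto simp: psi_def)
  then show "0 < Delta_left ell \<delta>" "ereal (Delta_left ell \<delta>) < Delta_max ell"
    "psi ell (Delta_left ell \<delta>) = \<delta>"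
    using eq x \<open>ereal x < Delta_max ell\<close> by auto
qed

text \<open>The solution set is closed by continuity and bounded below, so the \<open>LEAST\<close>
  over the reals is attained, at its infimum.\<close>

lemma Delta_right_le:
  assumes cont: "continuous_on {0..} (psi ell)" and x: "Delta_max ell \<le> ereal x" "psi ell x = \<delta>"
  shows "Delta_right ell \<delta> \<le> ereal x"
proof -
  obtain d where d: "Delta_max ell = ereal d" "0 \<le> d"
    using Delta_max_nonneg[of ell] x(1) by (cases "Delta_max ell") auto
  define S where "S = {x. Delta_max ell \<le> ereal x \<and> psi ell x = \<delta>}"
  have "S = {d..} \<inter> psi ell -` {\<delta>}" by (auto simp: S_def d)
  moreover have "continuous_on {d..} (psi ell)" by (rule continuous_on_subset[OF cont]) (use d in auto)
  ultimately have "closed S" by (simp add: continuous_closed_preimage)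
  have "x \<in> S" using x by (simp add: S_def)
  have bdd: "bdd_below S" by (rule bdd_belowI[of _ d]) (auto simp: S_def d)
  have "Inf S \<in> S" using \<open>closed S\<close> \<open>x \<in> S\<close> bdd by (intro closed_contains_Inf) auto
  then have "(LEAST x. Delta_max ell \<le> ereal x \<and> psi ell x = \<delta>) = Inf S"
    using cInf_lower[OF _ bdd] by (intro Least_equality) (auto simp: S_def)
  moreover have "Inf S \<le> x" by (rule cInf_lower[OF \<open>x \<in> S\<close> bdd])
  ultimately show ?thesis using x by (auto simp: Delta_right_def)
qed

text \<open>An \<open>x\<close> beyond \<open>Delta_left\<close> but below \<open>Delta_max\<close>
  contradicts monotonicity. If \<open>x\<close> is at or beyond \<open>Delta_max\<close>, then
  \<psi> has come down from above \<delta> and crossed that level at some \<open>z \<le> x\<close>,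
  which forces \<open>Delta_right\<close> to be at most \<open>M\<close>.\<close>

lemma le_Delta_left:
  assumes cont: "continuous_on {0..} (psi ell)" and "0 < \<delta>" and \<delta>: "ereal \<delta> < psi_Delta_max ell"
    and M: "ereal (2 * M) \<le> Delta_right ell \<delta>" and x: "0 \<le> x" "x \<le> M" "psi ell x \<le> \<delta>"
  shows "x \<le> Delta_left ell \<delta>"
proof (rule ccontr)
  note left = Delta_left_props[OF cont \<open>0 < \<delta>\<close> \<delta>]
  assume gt: "\<not> x \<le> Delta_left ell \<delta>"
  show False
  proof (cases "ereal x < Delta_max ell")
    case True
    then have "psi ell (Delta_left ell \<delta>) < psi ell x"
      using gt left x(1) by (intro strict_mono_onD[OF strict_mono_on_Delta_max]) auto
    then show False using left x by simp
  next
    case False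
    then obtain d where d: "Delta_max ell = ereal d" "0 \<le> d" "d \<le> x"
      using Delta_max_nonneg[of ell] by (cases "Delta_max ell") auto
    then have "\<delta> < psi ell d" using \<delta> by (simp add: psi_Delta_max_def)
    have "continuous_on {d..x} (psi ell)" by (rule continuous_on_subset[OF cont]) (use d in auto)
    then obtain z where z: "d \<le> z" "z \<le> x" "psi ell z = \<delta>"
      using IVT2'[of "psi ell" x \<delta> d] d \<open>\<delta> < psi ell d\<close> x(3) by auto
    then have "Delta_right ell \<delta> \<le> ereal z" using Delta_right_le[OF cont, of z] d by simp
    with M have "ereal (2 * M) \<le> ereal z" by (rule order_trans)
    \<comment> \<open>Now \<open>2 * M \<le> z \<le> x \<le> M\<close>, so \<open>M\<close> is at
      most 0, while \<open>x\<close> exceeds the positive \<open>Delta_left\<close>.\<close>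
    then show False using z x gt left(1) by simp
  qed
qed

section \<open>Complexity of the two phases\<close>

text \<open>Two regimes meet at the value 2: \<open>large\<close> counts the divisions by
  \<open>3 / 2\<close> needed to get there, and from then on \<open>small\<close> makes
  \<open>1 / a\<close> at least \<open>j / 3\<close> after \<open>j\<close> steps.\<close>

lemma inverse_sqrt_recursion_le:
  fixes a :: "nat \<Rightarrow> real"
  assumes a0: "0 < a 0" and step: "\<And>k. a (Suc k) = a k / sqrt (1 + a k)" and "0 < t"
    and N: "3 / t + max (1 + log (3 / 2) (a 0 / 2)) 0 \<le> real N"
  shows "a N \<le> t"
proof -
  have pos: "0 < a k" for k by (induction k) (use a0 step in auto)
  have large: "a k \<le> max 2 (a 0 / (3 / 2) ^ k)" for k
  proof (induction k)
    case (Suc k)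
    show ?case
    proof (cases "a k \<le> 2")
      case True
      have "a k / sqrt (1 + a k) \<le> a k / 1"
        using pos[of k] by (intro divide_left_mono) auto
      then show ?thesis using True step[of k] by simp
    next
      case False
      have "3 / 2 \<le> sqrt (1 + a k)"
        using False by (intro real_le_rsqrt) (simp add: power2_eq_square)
      then have "a (Suc k) \<le> a k / (3 / 2)"
        unfolding step using pos[of k] by (intro divide_left_mono) auto
      also have "\<dots> \<le> a 0 / (3 / 2) ^ k / (3 / 2)"
        using Suc False by (intro divide_right_mono) auto
      also have "\<dots> = a 0 / (3 / 2) ^ Suc k" by simp
      finally show ?thesis by (rule max.coboundedI2)
    qed
  qed simp
  have small: "a (m + j) \<le> 2 \<and> real j / 3 \<le> 1 / a (m + j)" if "a m \<le> 2" for m j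
  proof (induction j)
    case 0
    then show ?case using that pos[of m] by simp
  next
    case (Suc j)
    define r where "r = sqrt (1 + a (m + j))"
    have "1 \<le> r" using pos[of "m + j"] by (simp add: r_def)
    have "r \<le> 2" unfolding r_def using Suc by (intro real_le_lsqrt) auto
    have "a (m + j) = r\<^sup>2 - 1" using pos[of "m + j"] by (simp add: r_def)
    then have aj: "a (m + j) = (r - 1) * (r + 1)" by (simp add: power2_eq_square algebra_simps)
    have "1 < r" using pos[of "m + j"] by (simp add: r_def)
    have next_a: "a (m + Suc j) = a (m + j) / r" by (simp add: step r_def)
    \<comment> \<open>With \<open>r = sqrt (1 + a)\<close> the value \<open>a\<close> factors as
      \<open>(r - 1) * (r + 1)\<close>, so the increment is \<open>1 / (r + 1)\<close>.\<close>
    have "1 / a (m + Suc j) - 1 / a (m + j) = (r - 1) / a (m + j)"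
      using pos[of "m + j"] by (simp only: next_a) (simp add: diff_divide_distrib)
    also have "\<dots> = 1 / (r + 1)" using \<open>1 < r\<close> by (simp add: aj)
    also have "\<dots> \<ge> 1 / 3" using \<open>r \<le> 2\<close> \<open>1 < r\<close> by (intro divide_left_mono) auto
    finally have "1 / a (m + j) + 1 / 3 \<le> 1 / a (m + Suc j)" by simp
    moreover have "a (m + Suc j) \<le> a (m + j) / 1"
      unfolding next_a using pos[of "m + j"] \<open>1 \<le> r\<close> by (intro divide_left_mono) auto
    ultimately show ?case using Suc by (simp add: add_divide_distrib)
  qed
  define l where "l = log (3 / 2) (a 0 / 2)"
  \<comment> \<open>\<open>nat\<close> gives 0 if the start is already at most 2; the summand 1 in
    \<open>N\<close> pays for the ceiling.\<close>
  define m where "m = nat \<lceil>l\<rceil>"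
  have "l \<le> real m" unfolding m_def by linarith
  have "a 0 / 2 = (3 / 2) powr l" using a0 by (simp add: l_def)
  also have "\<dots> \<le> (3 / 2) powr (real m)" using \<open>l \<le> real m\<close> by simp
  also have "\<dots> = (3 / 2) ^ m" by (simp add: powr_realpow)
  finally have "a 0 / (3 / 2) ^ m \<le> 2" by (simp add: field_simps)
  then have am: "a m \<le> 2" using large[of m] by simp
  have "real m \<le> max (1 + l) 0" unfolding m_def by linarith
  then have mN: "real m + 3 / t \<le> real N" using N by (simp add: l_def)
  moreover have "0 < 3 / t" using \<open>0 < t\<close> by simp
  ultimately have "m \<le> N" by linarith
  then obtain j where j: "N = m + j" using le_Suc_ex by blast
  have "1 / t \<le> real j / 3" using mN by (simp add: j)
  also have "\<dots> \<le> 1 / a N" using small[OF am, of j] by (simp add: j)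
  finally show ?thesis using pos[of N] \<open>0 < t\<close> by (simp add: field_simps)
qed

section \<open>Passage from extended-real functions to the real-valued setting\<close>

lemma differentiable_imp_GDERIV:
  fixes h :: "'a::euclidean_space \<Rightarrow> real"
  assumes "h differentiable (at x)"
  obtains D where "GDERIV h x :> D"
proof -
  obtain h' where h': "(h has_derivative h') (at x)"
    using assms by (auto simp: differentiable_def)
  then have lin: "linear h'" by (rule has_derivative_linear)
  \<comment> \<open>Riesz representation: the adjoint at 1 is the gradient vector.\<close>
  have "h' v = v \<bullet> adjoint h' 1" for v
    using adjoint_works[OF lin, of v 1] by simp
  then have "h' = (\<lambda>v. v \<bullet> adjoint h' 1)" by blast
  then show ?thesis using that h' by (metis gderiv_def)
qed

lemma GDERIV_grad:
  fixes f :: "real ^ 'n \<Rightarrow> ereal"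
  assumes "(\<lambda>z. real_of_ereal (f z)) differentiable (at x)"
  shows "GDERIV (\<lambda>z. real_of_ereal (f z)) x :> grad f x"
proof -
  obtain D where D: "GDERIV (\<lambda>z. real_of_ereal (f z)) x :> D"
    using differentiable_imp_GDERIV[OF assms] .
  show ?thesis
    unfolding grad_def
  proof (rule theI)
    fix E assume "GDERIV (\<lambda>z. real_of_ereal (f z)) x :> E"
    then have "(\<lambda>h. h \<bullet> E) = (\<lambda>h. h \<bullet> D)"
      using D unfolding gderiv_def by (rule has_derivative_unique)
    then have "(E - D) \<bullet> E = (E - D) \<bullet> D" by (rule fun_cong)
    then have "(E - D) \<bullet> (E - D) = 0" by (simp add: inner_diff_right)
    then show "E = D" by simp
  qed (rule D)
qed

text \<open>The barrier property comes from the topology of the extended reals: \<open>f\<close> is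
  \<infinity> at a closure point outside \<open>edom f\<close>, and continuity there makes nearby
  values exceed every real.\<close>

lemma ell_smooth_imp_generalized_smooth:
  fixes f :: "real ^ 'n \<Rightarrow> ereal"
  assumes not_MInf: "\<And>x. f x \<noteq> -\<infinity>" and "open (edom f)" and "convex (edom f)"
    and "convex_on (edom f) (\<lambda>x. real_of_ereal (f x))" and smooth: "ell_smooth ell f"
  shows "generalized_smooth (edom f) (\<lambda>x. real_of_ereal (f x)) (grad f) (\<lambda>x. (*v) (hessian f x)) ell"
proof
  fix x assume x: "x \<in> edom f"
  then have diff: "(\<lambda>z. real_of_ereal (f z)) differentiable (at x)" "grad f differentiable (at x)"
    using smooth by (auto simp: ell_smooth_def twice_differentiable_on_edom_def)
  show "GDERIV (\<lambda>z. real_of_ereal (f z)) x :> grad f x" by (rule GDERIV_grad[OF diff(1)])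
  show "(grad f has_derivative (*v) (hessian f x)) (at x)"
    using diff(2) unfolding hessian_def by (simp add: jacobian_works)
  fix h
  have "norm (hessian f x *v h) \<le> spectral_norm (hessian f x) * norm h"
    unfolding spectral_norm_def by (rule onorm[OF matrix_vector_mul_bounded_linear])
  also have "\<dots> \<le> ell (norm (grad f x)) * norm h"
    using smooth x by (intro mult_right_mono) (auto simp: ell_smooth_def)
  finally show "norm (hessian f x *v h) \<le> ell (norm (grad f x)) * norm h" .
next
  fix z assume z: "z \<in> closure (edom f) - edom f"
  have "continuous_on (closure (edom f)) f" using smooth by (simp add: ell_smooth_def)
  then have "(f \<longlongrightarrow> f z) (at z within closure (edom f))"
    using z by (simp add: continuous_on_def)
  then have lim: "(f \<longlongrightarrow> f z) (at z within edom f)"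
    by (rule tendsto_within_subset) (rule closure_subset)
  have "f z = \<infinity>" using z by (auto simp: edom_def)
  show "filterlim (\<lambda>x. real_of_ereal (f x)) at_top (at z within edom f)"
    unfolding filterlim_at_top_dense
  proof
    fix Z :: real
    have "\<forall>\<^sub>F x in at z within edom f. ereal Z < f x"
      using lim by (rule order_tendstoD) (simp add: \<open>f z = \<infinity>\<close>)
    moreover have "\<forall>\<^sub>F x in at z within edom f. x \<in> edom f"
      by (simp add: eventually_at_filter)
    ultimately show "\<forall>\<^sub>F x in at z within edom f. Z < real_of_ereal (f x)"
    proof eventually_elim
      case (elim x)
      then show ?case by (cases "f x") (auto simp: edom_def)
    qed
  qed
qed (use assms in \<open>auto simp: ell_smooth_def\<close>)

text \<open>The infimum of the empty set is \<infinity>, so a finite one belongs to a nonempty set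
  of a well-order and is attained.\<close>

lemma oracle_complexity_eq_enatD:
  assumes "oracle_complexity f z P = enat n"
  shows "P (z n)" and "m < n \<Longrightarrow> z m \<in> edom f"
proof -
  let ?A = "{enat n |n. P (z n) \<and> (\<forall>m<n. z m \<in> edom f)}"
  have "?A \<noteq> {}"
  proof
    assume "?A = {}"
    then show False using assms unfolding oracle_complexity_def by (simp add: Inf_enat_def)
  qed
  then have "Inf ?A \<in> ?A" by (metis (lifting) ex_in_conv wellorder_InfI)
  then have "enat n \<in> ?A" using assms unfolding oracle_complexity_def by simp
  then show "P (z n)" and "m < n \<Longrightarrow> z m \<in> edom f" by auto
qed

lemma oracle_complexity_le:
  assumes "P (z n)" and "\<And>m. m < n \<Longrightarrow> z m \<in> edom f"
  shows "oracle_complexity f z P \<le> enat n"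
  unfolding oracle_complexity_def by (rule Inf_lower) (use assms in auto)

lemma gd_stepsize_bounds:
  assumes "mono_on {0..} ell" and pos: "\<And>s. s \<ge> 0 \<Longrightarrow> ell s > 0"
  shows "0 \<le> gd_stepsize f ell x" and "gd_stepsize f ell x \<le> 1 / ell (norm (grad f x))"
proof -
  define n where "n = norm (grad f x)"
  have "0 \<le> n" by (simp add: n_def)
  define h where "h v = 1 / ell (n + n * v)" for v
  have h: "0 \<le> h v \<and> h v \<le> 1 / ell n" if "v \<in> {0..1}" for v
  proof -
    have "0 \<le> n * v" using that \<open>0 \<le> n\<close> by simp
    then have "ell n \<le> ell (n + n * v)"
      using assms(1) \<open>0 \<le> n\<close> by (simp add: mono_on_def)
    then show ?thesis
      using pos[of "n + n * v"] pos[OF \<open>0 \<le> n\<close>] \<open>0 \<le> n\<close> \<open>0 \<le> n * v\<close>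
      by (auto simp: h_def intro!: divide_left_mono)
  qed
  have "0 \<le> integral {0..1} h \<and> integral {0..1} h \<le> 1 / ell n"
  proof (cases "h integrable_on {0..1}")
    case True
    have "integral {0..1} h \<le> integral {0..1} (\<lambda>v::real. 1 / ell n)"
      by (rule integral_le[OF True]) (use h in auto)
    moreover have "0 \<le> integral {0..1} h" by (rule integral_nonneg[OF True]) (use h in auto)
    ultimately show ?thesis by simp
  next
    \<comment> \<open>\<open>integral\<close> takes the default value 0 here, which meets both
      bounds.\<close>
    case False
    then show ?thesis using pos[OF \<open>0 \<le> n\<close>] by (simp add: not_integrable_integral less_imp_le)
  qed
  then show "0 \<le> gd_stepsize f ell x" and "gd_stepsize f ell x \<le> 1 / ell (norm (grad f x))"
    by (simp_all add: gd_stepsize_def h_def[abs_def] n_def)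
qed

text \<open>Only the queried iterates, those before \<open>J\<close>, are assumed to lie in the
  domain.\<close>

lemma gd_dist_le:
  fixes f :: "real ^ 'n \<Rightarrow> ereal"
  assumes "generalized_smooth (edom f) F (grad f) H ell"
    and "xs \<in> edom f" and "\<And>x. x \<in> edom f \<Longrightarrow> F xs \<le> F x"
    and "\<And>j. j < J \<Longrightarrow> gd f ell x0 j \<in> edom f"
  shows "norm (gd f ell x0 J - xs) \<le> norm (x0 - xs)"
  using assms(4)
proof (induction J)
  case (Suc J)
  interpret generalized_smooth "edom f" F "grad f" H ell by fact
  have "norm (gd f ell x0 (Suc J) - xs) \<le> norm (gd f ell x0 J - xs)"
    unfolding gd.simps
    by (rule grad_step_nonexpansive[OF assms(2,3) Suc.prems])
      (simp_all add: gd_stepsize_bounds[OF ell_mono ell_pos])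
  also have "\<dots> \<le> norm (x0 - xs)" using Suc by simp
  finally show ?case .
qed simp

text \<open>\<open>psi ell D\<close> plays the part of \<delta>. The invariant supplies what
  \<open>accelerated_step\<close> asks for, and \<open>gradD\<close> turns it into the gradient
  bound at each iterate.\<close>

lemma phase2_invariant:
  fixes f :: "real ^ 'n \<Rightarrow> ereal"
  assumes "generalized_smooth (edom f) F (grad f) H ell"
    and xs: "xs \<in> edom f" and xs_min: "\<And>x. x \<in> edom f \<Longrightarrow> F xs \<le> F x"
    and "0 < R" and "0 < D" and ellD: "ell (4 * D) \<le> 2 * ell 0"
    and gradD: "\<And>x. x \<in> edom f \<Longrightarrow> F x - F xs \<le> psi ell D \<Longrightarrow> norm (x - xs) \<le> 2 * R
      \<Longrightarrow> norm (grad f x) \<le> D"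
    and xbar: "xbar \<in> edom f" "F xbar - F xs \<le> psi ell D / 2" "norm (xbar - xs) \<le> R"
    and state: "phase2 f ell (psi ell D) R xbar k = (y, u, \<Gamma>)"
  shows "y \<in> edom f" and "0 < \<Gamma>" and "\<Gamma> * R\<^sup>2 \<le> psi ell D"
    and "F y - F xs + \<Gamma> / 2 * (norm (u - xs))\<^sup>2 \<le> \<Gamma> * R\<^sup>2"
    and "norm (y - xs) \<le> sqrt 2 * R"
proof -
  interpret generalized_smooth "edom f" F "grad f" H ell by fact
  have psi_pos: "0 < psi ell D" using \<open>0 < D\<close> ell_pos[of "4 * D"] by (simp add: psi_def)
  have "y \<in> edom f \<and> 0 < \<Gamma> \<and> \<Gamma> * R\<^sup>2 \<le> psi ell D
      \<and> F y - F xs + \<Gamma> / 2 * (norm (u - xs))\<^sup>2 \<le> \<Gamma> * R\<^sup>2 \<and> norm (y - xs) \<le> sqrt 2 * R"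
    using state
  proof (induction k arbitrary: y u \<Gamma>)
    case 0
    then have eqs: "y = xbar" "u = xbar" "\<Gamma> = psi ell D / R\<^sup>2" by auto
    \<comment> \<open>Gap and distance term each start at no more than \<open>psi ell D / 2\<close>,
      which explains the target \<delta>/2 of Phase 1.\<close>
    have "(norm (xbar - xs))\<^sup>2 \<le> R\<^sup>2" using xbar(3) by (intro power_mono) auto
    then have "\<Gamma> / 2 * (norm (xbar - xs))\<^sup>2 \<le> \<Gamma> / 2 * R\<^sup>2"
      using psi_pos eqs by (intro mult_left_mono) auto
    moreover have \<Gamma>R: "\<Gamma> * R\<^sup>2 = psi ell D" using \<open>0 < R\<close> eqs by simp
    ultimately have "F y - F xs + \<Gamma> / 2 * (norm (u - xs))\<^sup>2 \<le> \<Gamma> * R\<^sup>2"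
      using xbar(2) unfolding eqs(1,2) by simp
    moreover have "1 * R \<le> sqrt 2 * R" using \<open>0 < R\<close> by (intro mult_right_mono) auto
    then have "norm (xbar - xs) \<le> sqrt 2 * R" using xbar(3) by linarith
    ultimately show ?case using xbar \<Gamma>R psi_pos \<open>0 < R\<close> by (simp add: eqs)
  next
    case (Suc k)
    obtain y0 u0 \<Gamma>0 where st: "phase2 f ell (psi ell D) R xbar k = (y0, u0, \<Gamma>0)"
      by (metis prod.exhaust)
    have IH: "y0 \<in> edom f" "0 < \<Gamma>0" "\<Gamma>0 * R\<^sup>2 \<le> psi ell D"
      "F y0 - F xs + \<Gamma>0 / 2 * (norm (u0 - xs))\<^sup>2 \<le> \<Gamma>0 * R\<^sup>2" "norm (y0 - xs) \<le> sqrt 2 * R"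
      using Suc.IH[OF st] by auto
    define \<gamma> where "\<gamma> = 1 / (2 * ell 0)"
    define \<alpha> where "\<alpha> = sqrt (\<gamma> * \<Gamma>0)"
    have y: "y = (1 / (1 + \<alpha>)) *\<^sub>R y0 + (\<alpha> / (1 + \<alpha>)) *\<^sub>R u0 - (\<gamma> / (1 + \<alpha>)) *\<^sub>R grad f y0"
      and u: "u = closest_point (closure (edom f)) (u0 - (\<alpha> / \<Gamma>0) *\<^sub>R grad f y)"
      and \<Gamma>: "\<Gamma> = \<Gamma>0 / (1 + \<alpha>)"
      using Suc.prems by (auto simp: st phase2_step_def Let_def \<gamma>_def \<alpha>_def)
    have "0 < \<alpha>" using IH ell_pos[of 0] by (simp add: \<alpha>_def \<gamma>_def)
    have "0 \<le> \<Gamma>0 / 2 * (norm (u0 - xs))\<^sup>2" using IH by simp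
    then have "F y0 - F xs \<le> psi ell D" using IH by linarith
    moreover have "sqrt 2 * R \<le> 2 * R"
      using \<open>0 < R\<close> by (intro mult_right_mono real_le_lsqrt) auto
    ultimately have gD: "norm (grad f y0) \<le> D" using IH by (intro gradD) auto
    \<comment> \<open>The projection is nonexpansive and fixes \<open>xs\<close>.\<close>
    have "norm (u - xs) \<le> norm (u0 - (\<alpha> / \<Gamma>0) *\<^sub>R grad f y - xs)"
    proof -
      have "closest_point (closure (edom f)) xs = xs"
        using xs closure_subset by (intro closest_point_self) auto
      then show ?thesis
        using closest_point_lipschitz[of "closure (edom f)" "u0 - (\<alpha> / \<Gamma>0) *\<^sub>R grad f y" xs]
          convex_X xs convex_closure by (auto simp: u dist_norm)
    qed
    note step = accelerated_step[OF xs xs_min IH(1) \<open>0 < D\<close> gD ellD IH(2) less_imp_le[OF \<open>0 < R\<close>] IH(3-5)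
        \<gamma>_def \<alpha>_def y this]
    have "\<Gamma> * R\<^sup>2 \<le> \<Gamma>0 * R\<^sup>2"
      unfolding \<Gamma> using \<open>0 < \<alpha>\<close> IH by (intro mult_right_mono) (auto simp: field_simps)
    then show ?case
      using step IH(2,3) \<open>0 < \<alpha>\<close> by (auto simp: \<Gamma>)
  qed
  then show "y \<in> edom f" and "0 < \<Gamma>" and "\<Gamma> * R\<^sup>2 \<le> psi ell D"
    and "F y - F xs + \<Gamma> / 2 * (norm (u - xs))\<^sup>2 \<le> \<Gamma> * R\<^sup>2"
    and "norm (y - xs) \<le> sqrt 2 * R" by auto
qed


text \<open>In the variable \<open>a\<close> the target reads \<open>a N \<le> t\<close>. The
  constant 5 bounds \<open>3 * sqrt 2\<close>, where 3 comes from the recursion and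
  \<open>sqrt 2\<close> from \<gamma>.\<close>

lemma phase2_rate:
  assumes "0 < ell 0" "0 < R" "0 < \<epsilon>" "0 < \<delta>"
    and N: "5 * sqrt (ell 0) * R / sqrt \<epsilon>
      + max (1 + 1 / 2 * log (3 / 2) (\<delta> / (8 * ell 0 * R\<^sup>2))) 0 \<le> real N"
  shows "snd (snd (phase2 f ell \<delta> R xbar N)) * R\<^sup>2 \<le> \<epsilon>"
proof -
  define \<Gamma> where "\<Gamma> k = snd (snd (phase2 f ell \<delta> R xbar k))" for k
  define \<gamma> where "\<gamma> = 1 / (2 * ell 0)"
  define a where "a k = sqrt (\<gamma> * \<Gamma> k)" for k
  define t where "t = sqrt (\<gamma> * \<epsilon>) / R"
  have "0 < \<gamma>" using \<open>0 < ell 0\<close> by (simp add: \<gamma>_def)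
  then have "0 < t" using assms by (simp add: t_def)
  have \<Gamma>0: "\<Gamma> 0 = \<delta> / R\<^sup>2" by (simp add: \<Gamma>_def)
  have \<Gamma>Suc: "\<Gamma> (Suc k) = \<Gamma> k / (1 + a k)" for k
    by (cases "phase2 f ell \<delta> R xbar k") (simp add: \<Gamma>_def a_def \<gamma>_def phase2_step_def Let_def)
  have "0 < a 0" using \<open>0 < \<gamma>\<close> assms by (simp add: a_def \<Gamma>0)
  moreover have "a (Suc k) = a k / sqrt (1 + a k)" for k
    by (simp add: a_def[of "Suc k"] \<Gamma>Suc real_sqrt_divide real_sqrt_mult) (simp add: a_def real_sqrt_mult)
  moreover have "3 / t + max (1 + log (3 / 2) (a 0 / 2)) 0 \<le> real N"
  proof -
    have "sqrt \<gamma> = 1 / (sqrt 2 * sqrt (ell 0))"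
      by (simp add: \<gamma>_def real_sqrt_divide real_sqrt_mult)
    then have "3 / t = 3 * sqrt 2 * (sqrt (ell 0) * R / sqrt \<epsilon>)"
      by (simp add: t_def real_sqrt_mult)
    also have "\<dots> \<le> 5 * (sqrt (ell 0) * R / sqrt \<epsilon>)"
    proof (rule mult_right_mono)
      have "sqrt 2 \<le> 5 / 3" by (rule real_le_lsqrt) (simp_all add: power2_eq_square)
      then show "3 * sqrt 2 \<le> 5" by simp
    qed (use assms in simp)
    finally have "3 / t \<le> 5 * sqrt (ell 0) * R / sqrt \<epsilon>" by simp
    \<comment> \<open>This square explains the 8 and the factor \<open>1 / 2\<close> before the
      logarithm.\<close>
    moreover have "\<delta> / (8 * ell 0 * R\<^sup>2) = (a 0 / 2)\<^sup>2"
      using \<open>0 < \<gamma>\<close> assms by (simp add: a_def \<Gamma>0 power_divide \<gamma>_def)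
    then have "log (3 / 2) (\<delta> / (8 * ell 0 * R\<^sup>2)) = 2 * log (3 / 2) (a 0 / 2)"
      using \<open>0 < a 0\<close> log_nat_power[of "a 0 / 2" "3 / 2" 2] by simp
    ultimately show ?thesis using N by simp
  qed
  ultimately have "a N \<le> t" using \<open>0 < t\<close> by (intro inverse_sqrt_recursion_le[of a])
  then have "a N \<le> sqrt (\<gamma> * (\<epsilon> / R\<^sup>2))"
    using \<open>0 < R\<close> by (simp add: t_def real_sqrt_divide)
  then have "\<gamma> * \<Gamma> N \<le> \<gamma> * (\<epsilon> / R\<^sup>2)" by (simp only: a_def real_sqrt_le_iff)
  then have "\<Gamma> N \<le> \<epsilon> / R\<^sup>2" using \<open>0 < \<gamma>\<close> by (rule mult_left_le_imp_le)
  then show ?thesis using \<open>0 < R\<close> by (simp add: \<Gamma>_def field_simps)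
qed

theorem theorem5p2:
  fixes f :: "real ^ 'n \<Rightarrow> ereal" and ell :: "real \<Rightarrow> real"
    and xs x0 :: "real ^ 'n" and \<Delta> :: ereal and R M \<epsilon> \<delta> :: real
  assumes "\<And>x. f x \<noteq> -\<infinity>"
    and "open (edom f)" and "convex (edom f)" and "edom f \<noteq> {}"
    and "convex_on (edom f) (\<lambda>x. real_of_ereal (f x))"
    and "ell_smooth ell f"
    and "\<And>x. f xs \<le> f x"
    and "x0 \<in> edom f"
    and "\<Delta> = f x0 - f xs"
    and "R > 0" and "R \<ge> norm (x0 - xs)"
    and "\<And>x. f x - f xs \<le> \<Delta> \<Longrightarrow> norm (x - xs) \<le> 2 * R \<Longrightarrow> norm (grad f x) \<le> M"
    and "\<epsilon> > 0"
    and "\<delta> \<in> Q_set ell \<Delta> M"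
  shows "ereal_of_enat (alg1_complexity f ell xs x0 \<delta> R \<epsilon>)
    \<le> ereal_ceiling (ereal (5 * sqrt (ell 0) * R / sqrt \<epsilon>) + k_bound f ell xs x0 R \<delta>)"
proof (cases "k_GD f ell xs x0 \<delta>")
  case infinity
  then show ?thesis by (simp add: k_bound_def ereal_ceiling_def)
next
  case (enat J)
  define F where "F x = real_of_ereal (f x)" for x
  have smooth: "generalized_smooth (edom f) F (grad f) (\<lambda>x. (*v) (hessian f x)) ell"
    unfolding F_def[abs_def] by (rule ell_smooth_imp_generalized_smooth) fact+
  interpret generalized_smooth "edom f" F "grad f" "\<lambda>x. (*v) (hessian f x)" ell by (rule smooth)
  have f_eq: "f x = ereal (F x)" if "x \<in> edom f" for x
    using that assms(1)[of x] by (cases "f x") (auto simp: F_def edom_def)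
  have xs: "xs \<in> edom f"
    using assms(7)[of x0] assms(8) by (auto simp: edom_def intro: le_less_trans)
  have xs_min: "F xs \<le> F x" if "x \<in> edom f" for x
    using assms(7)[of x] by (simp add: f_eq xs that)
  have INF_f: "(INF y. f y) = f xs"
    by (rule antisym) (auto intro: INF_lower INF_greatest assms(7))
  have eps_iff: "eps_solution f \<epsilon> x \<longleftrightarrow> F x - F xs \<le> \<epsilon>" if "x \<in> edom f" for x
    using that by (simp add: eps_solution_def INF_f f_eq xs)

  define xbar where "xbar = gd f ell x0 J"
  have gap: "f xbar - f xs \<le> ereal (\<delta> / 2)" and iterates: "\<And>j. j < J \<Longrightarrow> gd f ell x0 j \<in> edom f"
    using oracle_complexity_eq_enatD[OF enat[unfolded k_GD_def]] by (auto simp: xbar_def)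
  \<comment> \<open>The point \<open>xbar\<close> is not among the queried ones; its finite gap
    places it in the domain.\<close>
  have xbar: "xbar \<in> edom f"
    using gap by (cases "f xbar") (auto simp: edom_def f_eq[OF xs])
  have "norm (xbar - xs) \<le> R"
    unfolding xbar_def using gd_dist_le[OF smooth xs xs_min iterates] assms(11) by (rule order_trans)
  have gapF: "F xbar - F xs \<le> \<delta> / 2" using gap by (simp add: f_eq xs xbar)
  have \<delta>: "0 \<le> \<delta>" "ereal \<delta> \<le> ereal (1 / 2) * psi_Delta_max ell"
    "ell (4 * Delta_left ell \<delta>) \<le> 2 * ell 0" "ereal (2 * M) \<le> Delta_right ell \<delta>" "ereal \<delta> \<le> \<Delta>"
    using assms(14) by (auto simp: Q_set_def)
  define A where "A = 5 * sqrt (ell 0) * R / sqrt \<epsilon>"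
  have "0 < ell 0" by (simp add: ell_pos)
  then have "0 \<le> A" using assms(10,13) by (simp add: A_def)
  have alg: "alg1_complexity f ell xs x0 \<delta> R \<epsilon>
      = enat J + oracle_complexity f (phase2_y f ell \<delta> R xbar) (eps_solution f \<epsilon>)"
    by (simp add: alg1_complexity_def enat xbar_def)

  show ?thesis
  proof (cases "\<delta> = 0")
    case True
    then have "eps_solution f \<epsilon> xbar" using gapF \<open>0 < \<epsilon>\<close> by (simp add: eps_iff xbar)
    then have "oracle_complexity f (phase2_y f ell \<delta> R xbar) (eps_solution f \<epsilon>) \<le> enat 0"
      by (intro oracle_complexity_le) (simp_all add: phase2_y_def)
    then have "alg1_complexity f ell xs x0 \<delta> R \<epsilon> = enat J"
      by (simp add: alg flip: zero_enat_def)
    \<comment> \<open>\<open>log0\<close> is -\<infinity> here, so the maximum is 0.\<close>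
    moreover have "k_bound f ell xs x0 R \<delta> = ereal (real J)"
      by (simp add: k_bound_def True log0_def enat[unfolded True] one_ereal_def max_def)
    moreover have "real J \<le> real_of_int \<lceil>A + real J\<rceil>" using \<open>0 \<le> A\<close> by linarith
    ultimately show ?thesis by (simp add: ereal_ceiling_def flip: A_def)
  next
    case False
    then have "0 < \<delta>" using \<delta>(1) by simp
    \<comment> \<open>The factor \<open>1 / 2\<close> in \<open>Q_set\<close> yields strictness for
      positive \<delta>.\<close>
    have \<delta>': "ereal \<delta> < psi_Delta_max ell"
      using \<delta>(2) \<open>0 < \<delta>\<close> by (cases "psi_Delta_max ell") auto
    have "locally_lipschitz_on {0..} ell" using assms(6) by (simp add: ell_smooth_def)
    then have cont: "continuous_on {0..} (psi ell)"
      by (intro continuous_on_psi locally_lipschitz_on_imp_continuous_on ell_pos)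
    define D where "D = Delta_left ell \<delta>"
    have "0 < D" and psiD: "psi ell D = \<delta>"
      using Delta_left_props[OF cont \<open>0 < \<delta>\<close> \<delta>'] by (simp_all add: D_def)
    have gradD: "norm (grad f x) \<le> D" if x: "x \<in> edom f" "F x - F xs \<le> \<delta>" "norm (x - xs) \<le> 2 * R" for x
    proof -
      have "f x - f xs \<le> ereal \<delta>" using x by (simp add: f_eq xs)
      then have "norm (grad f x) \<le> M"
        using \<delta>(5) by (intro assms(12) x) (rule order_trans)
      moreover have "psi ell (norm (grad f x)) \<le> \<delta>"
        using gap_ge_psi[OF xs xs_min x(1)] x(2) by simp
      ultimately show ?thesis
        unfolding D_def by (intro le_Delta_left[OF cont \<open>0 < \<delta>\<close> \<delta>' \<delta>(4)]) auto
    qed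
    define B where "B = max (1 + 1 / 2 * log (3 / 2) (\<delta> / (8 * ell 0 * R\<^sup>2))) 0"
    define N where "N = nat \<lceil>A + B\<rceil>"
    have inv: "y \<in> edom f" "F y - F xs \<le> \<Gamma> * R\<^sup>2"
      if st: "phase2 f ell \<delta> R xbar k = (y, u, \<Gamma>)" for k y u \<Gamma>
    proof -
      note i = phase2_invariant[OF smooth xs _ assms(10) \<open>0 < D\<close> \<delta>(3)[folded D_def] _ xbar _
          \<open>norm (xbar - xs) \<le> R\<close>, of k y u \<Gamma>, unfolded psiD]
      show "y \<in> edom f" by (rule i(1)) (use xs_min gradD gapF st in auto)
      have "0 < \<Gamma>" by (rule i(2)) (use xs_min gradD gapF st in auto)
      then have "0 \<le> \<Gamma> / 2 * (norm (u - xs))\<^sup>2" by simp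
      moreover have "F y - F xs + \<Gamma> / 2 * (norm (u - xs))\<^sup>2 \<le> \<Gamma> * R\<^sup>2"
        by (rule i(4)) (use xs_min gradD gapF st in auto)
      ultimately show "F y - F xs \<le> \<Gamma> * R\<^sup>2" by linarith
    qed
    have y: "phase2_y f ell \<delta> R xbar k \<in> edom f" for k
      by (cases "phase2 f ell \<delta> R xbar k") (simp add: phase2_y_def inv(1))
    obtain yN uN \<Gamma>N where N: "phase2 f ell \<delta> R xbar N = (yN, uN, \<Gamma>N)"
      by (metis prod.exhaust)
    have "F yN - F xs \<le> \<Gamma>N * R\<^sup>2" by (rule inv(2)[OF N])
    moreover have "A + B \<le> real N" unfolding N_def by linarith
    then have "\<Gamma>N * R\<^sup>2 \<le> \<epsilon>"
      using phase2_rate[of ell R \<epsilon> \<delta> N f xbar] \<open>0 < ell 0\<close> assms(10,13) \<open>0 < \<delta>\<close> N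
      by (simp add: A_def B_def)
    ultimately have "eps_solution f \<epsilon> (phase2_y f ell \<delta> R xbar N)"
      using y[of N] by (simp add: eps_iff) (simp add: phase2_y_def N)
    then have "oracle_complexity f (phase2_y f ell \<delta> R xbar) (eps_solution f \<epsilon>) \<le> enat N"
      using y by (rule oracle_complexity_le)
    then have "alg1_complexity f ell xs x0 \<delta> R \<epsilon> \<le> enat J + enat N"
      unfolding alg by (rule add_left_mono)
    then have "ereal_of_enat (alg1_complexity f ell xs x0 \<delta> R \<epsilon>) \<le> ereal (real J + real N)"
      by (metis ereal_of_enat_le_iff ereal_of_enat_simps(1) of_nat_add plus_enat_simps(1))
    \<comment> \<open>The integer \<open>J\<close> moves out of the ceiling, so rounding the Phase 2
      bound alone gives the same total; nonnegativity makes \<open>nat\<close> harmless.\<close>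
    moreover have "0 \<le> \<lceil>A + B\<rceil>" using \<open>0 \<le> A\<close> by (simp add: B_def add_nonneg_nonneg)
    then have "real J + real N = real_of_int \<lceil>A + (B + real J)\<rceil>"
      using ceiling_add_of_int[of "A + B" "int J"] by (simp add: N_def add.assoc)
    moreover have "k_bound f ell xs x0 R \<delta> = ereal (B + real J)"
      using False assms(10) \<open>0 < ell 0\<close>
      by (simp add: k_bound_def log0_def enat one_ereal_def B_def zero_ereal_def max_def)
    ultimately show ?thesis by (simp add: ereal_ceiling_def A_def)
  qed
qed

end
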